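(* Let $\Sigma$ be a simplicial complex on the finite vertex set $V$ with $n=\#V$, and let $k,\ell$ be integers with $k-1\ge\ell\ge0$. Let $\mu_\ell^H=\min\sigma(\Delta_\ell^H)$ and suppose \[\mu_\ell^H> n\left(1-\frac{(\ell+1)!}{(k+1)!}\prod_{j=\ell+1}^{k}(j+1-\beta_j)\right).\] Then $H^k(\Sigma,\mathbb R)=\{0\}$.
   Context: A simplicial complex on a finite set $V$ is a family $\Sigma\subseteq\mathcal P(V)$ closed under taking subsets. $\Sigma_k$ is the set of $\sigma\in\Sigma$ with $\#\sigma=k+1$ (so $\Sigma_{-1}=\{\emptyset\}$ for nonempty $\Sigma$). Write $\tau\prec\sigma$ if $\tau\subseteq\sigma$ and $\#(\sigma\setminus\tau)=1$. $\mathcal K=\mathcal P(V)$ is the complete complex, $\mathcal K_k$ its simplices of cardinality $k+1$. $\ell^2(\Sigma_k)$ is the space of real valued functions on $\Sigma_k$ with $\langle\phi,\psi\rangle=\sum_{\tau\in\Sigma_k}\phi(\tau)\psi(\tau)$. Coboundary operators are linear maps $\delta_k:\ell^2(\Sigma_k)\to\ell^2(\Sigma_{k+1})$, $k\ge-1$, with $\delta_{k+1}\delta_k=0$ and $\delta_k1_\tau(\sigma)\in\{\pm1,0\}$, nonzero iff $\tau\prec\sigma$. They are chosen as follows: fix coboundary operators $\widehat\delta_k$ for $\mathcal K$ and put $\delta_k=\pi_{k+1}\widehat\delta_k\iota_k$, where $\iota_k:\ell^2(\Sigma_k)\to\ell^2(\mathcal K_k)$ is extension by zero and $\pi_k:\ell^2(\mathcal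 K_k)\to\ell^2(\Sigma_k)$ is restriction. (The usual oriented simplicial coboundary of the augmented cochain complex is an example; the spectra below do not depend on the choice.) Let $\partial_k=\delta_k^*$ be the adjoint and $\Delta_k^H=\partial_k\delta_k+\delta_{k-1}\partial_{k-1}$ on $\ell^2(\Sigma_k)$, $k\ge0$. $\sigma(A)$ denotes the spectrum of an operator $A$; $\mu_\ell^H$, the smallest eigenvalue of $\Delta_\ell^H$, is defined when $\Sigma_\ell\neq\emptyset$. The $k$-th reduced cohomology group is $H^k(\Sigma,\mathbb R)=\ker\delta_k/\mathrm{ran}\,\delta_{k-1}$, $k\ge0$. Let $A_k=\{\sigma\in\mathcal K_{k+1}\setminus\Sigma_{k+1}\mid \text{there is }\tau\in\Sigma_k\text{ with }\tau\subseteq\sigma\}$ and $\beta_k=\max_{\sigma\in A_k}\#\{\tau\in\Sigma_k\mid\tau\subseteq\sigma\}-1$, with $\beta_k=0$ if $A_k=\emptyset$. *)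

theory Defs
  imports Complex_Main "HOL-Library.Indicator_Function" "HOL-Library.FuncSet"
    "HOL-Algebra.Elementary_Groups"
begin

definition simplicial_complex :: "'a set \<Rightarrow> 'a set set \<Rightarrow> bool" where
  "simplicial_complex V S \<longleftrightarrow> S \<subseteq> Pow V \<and> (\<forall>\<sigma>\<in>S. \<forall>\<tau>\<subseteq>\<sigma>. \<tau> \<in> S)"

text \<open>Dimensions are integers, because the augmented complex starts in dimension \<open>-1\<close>
  (the empty simplex). The complete complex on \<open>V\<close> is \<open>Pow V\<close>.\<close>

definition simplices :: "'a set set \<Rightarrow> int \<Rightarrow> 'a set set" where
  "simplices S k = {\<sigma> \<in> S. int (card \<sigma>) = k + 1}"

definition facet :: "'a set \<Rightarrow> 'a set \<Rightarrow> bool" where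
  "facet \<tau> \<sigma> \<longleftrightarrow> \<tau> \<subseteq> \<sigma> \<and> card (\<sigma> - \<tau>) = 1"

text \<open>Functions on the \<open>k\<close>-simplices are represented by total functions that vanish
  elsewhere. With this encoding extension by zero, from a subcomplex to the complete complex,
  is the set inclusion.\<close>

definition l2 :: "'a set set \<Rightarrow> int \<Rightarrow> ('a set \<Rightarrow> real) set" where
  "l2 S k = {\<phi>. \<forall>\<tau>. \<tau> \<notin> simplices S k \<longrightarrow> \<phi> \<tau> = 0}"

definition l2_inner ::
    "'a set set \<Rightarrow> int \<Rightarrow> ('a set \<Rightarrow> real) \<Rightarrow> ('a set \<Rightarrow> real) \<Rightarrow> real" where
  "l2_inner S k \<phi> \<psi> = (\<Sum>\<tau>\<in>simplices S k. \<phi> \<tau> * \<psi> \<tau>)"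

definition l2_restrict :: "'a set set \<Rightarrow> int \<Rightarrow> ('a set \<Rightarrow> real) \<Rightarrow> 'a set \<Rightarrow> real" where
  "l2_restrict S k \<phi> = (\<lambda>\<tau>. if \<tau> \<in> simplices S k then \<phi> \<tau> else 0)"

definition linear_between ::
    "('b \<Rightarrow> real) set \<Rightarrow> ('b \<Rightarrow> real) set \<Rightarrow> (('b \<Rightarrow> real) \<Rightarrow> 'b \<Rightarrow> real) \<Rightarrow> bool" where
  "linear_between E F T \<longleftrightarrow>
     T \<in> E \<rightarrow> F \<and>
     (\<forall>\<phi>\<in>E. \<forall>\<psi>\<in>E. T (\<lambda>x. \<phi> x + \<psi> x) = (\<lambda>x. T \<phi> x + T \<psi> x)) \<and>
     (\<forall>c. \<forall>\<phi>\<in>E. T (\<lambda>x. c * \<phi> x) = (\<lambda>x. c * T \<phi> x))"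

type_synonym 'a graded_operator = "int \<Rightarrow> ('a set \<Rightarrow> real) \<Rightarrow> 'a set \<Rightarrow> real"

definition coboundary_operators :: "'a set set \<Rightarrow> 'a graded_operator \<Rightarrow> bool" where
  "coboundary_operators S d \<longleftrightarrow> (\<forall>k\<ge>-1.
     linear_between (l2 S k) (l2 S (k + 1)) (d k) \<and>
     (\<forall>\<phi>\<in>l2 S k. d (k + 1) (d k \<phi>) = (\<lambda>_. 0)) \<and>
     (\<forall>\<tau>\<in>simplices S k. \<forall>\<sigma>\<in>simplices S (k + 1).
        d k (indicator {\<tau>}) \<sigma> \<in> {1, -1, 0} \<and>
        (d k (indicator {\<tau>}) \<sigma> \<noteq> 0 \<longleftrightarrow> facet \<tau> \<sigma>)))"

definition induced_coboundary ::
    "'a set set \<Rightarrow> 'a graded_operator \<Rightarrow> 'a graded_operator" where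
  "induced_coboundary S dhat k \<phi> = l2_restrict S (k + 1) (dhat k \<phi>)"

text \<open>The adjoint of \<open>d k\<close>; its values are determined on \<open>l2 S (k + 1)\<close> only.\<close>

definition boundary :: "'a set set \<Rightarrow> 'a graded_operator \<Rightarrow> 'a graded_operator" where
  "boundary S d k = (SOME T. T \<in> l2 S (k + 1) \<rightarrow> l2 S k \<and>
     (\<forall>\<phi>\<in>l2 S k. \<forall>\<psi>\<in>l2 S (k + 1).
        l2_inner S (k + 1) (d k \<phi>) \<psi> = l2_inner S k \<phi> (T \<psi>)))"

definition hodge_laplacian :: "'a set set \<Rightarrow> 'a graded_operator \<Rightarrow> 'a graded_operator" where
  "hodge_laplacian S d k \<phi> =
     (\<lambda>\<tau>. boundary S d k (d k \<phi>) \<tau> + d (k - 1) (boundary S d (k - 1) \<phi>) \<tau>)"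

text \<open>The spectrum of an operator on a finite-dimensional function space \<open>E\<close>, as its set of
  eigenvalues. Real eigenvalues suffice, since only self-adjoint operators are considered.\<close>

definition spectrum_on ::
    "('b \<Rightarrow> real) set \<Rightarrow> (('b \<Rightarrow> real) \<Rightarrow> 'b \<Rightarrow> real) \<Rightarrow> real set" where
  "spectrum_on E A = {r. \<exists>\<phi>\<in>E. \<phi> \<noteq> (\<lambda>_. 0) \<and> A \<phi> = (\<lambda>x. r * \<phi> x)}"

definition mu_hodge :: "'a set set \<Rightarrow> 'a graded_operator \<Rightarrow> int \<Rightarrow> real" where
  "mu_hodge S d l = Min (spectrum_on (l2 S l) (hodge_laplacian S d l))"

definition cocycle_group ::
    "'a set set \<Rightarrow> 'a graded_operator \<Rightarrow> int \<Rightarrow> ('a set \<Rightarrow> real) monoid" where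
  "cocycle_group S d k =
     \<lparr>carrier = {\<phi> \<in> l2 S k. d k \<phi> = (\<lambda>_. 0)},
      mult = (\<lambda>\<phi> \<psi> \<tau>. \<phi> \<tau> + \<psi> \<tau>),
      one = (\<lambda>_. 0)\<rparr>"

definition reduced_cohomology ::
    "'a set set \<Rightarrow> 'a graded_operator \<Rightarrow> int \<Rightarrow> ('a set \<Rightarrow> real) set monoid" where
  "reduced_cohomology S d k = cocycle_group S d k Mod (d (k - 1) ` l2 S (k - 1))"

definition missing_simplices :: "'a set \<Rightarrow> 'a set set \<Rightarrow> int \<Rightarrow> 'a set set" where
  "missing_simplices V S k =
     {\<sigma> \<in> simplices (Pow V) (k + 1) - simplices S (k + 1). \<exists>\<tau>\<in>simplices S k. \<tau> \<subseteq> \<sigma>}"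

definition beta :: "'a set \<Rightarrow> 'a set set \<Rightarrow> int \<Rightarrow> int" where
  "beta V S k =
     (if missing_simplices V S k = {} then 0
      else int (MAX \<sigma>\<in>missing_simplices V S k. card {\<tau> \<in> simplices S k. \<tau> \<subseteq> \<sigma>}) - 1)"

end

theory Submission
  imports Defs "HOL-Analysis.Function_Topology"
begin

text \<open>
  On the complete complex the Hodge Laplacian is multiplication by \<open>n = card V\<close>. Hence for a cochain
  \<open>\<phi>\<close> on \<open>S\<close> the quantity \<open>n * \<parallel>\<phi>\<parallel>\<^sup>2 - \<langle>\<Delta> \<phi>, \<phi>\<rangle>\<close> is the defect of \<open>\<phi>\<close>: the sum of the squares of the complete
  coboundary of \<open>\<phi>\<close> over the non-simplices. Localising a \<open>j\<close>-cochain at each vertex \<open>u\<close> yields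
  \<open>(j-1)\<close>-cochains \<open>link u \<phi>\<close> whose squared norms add up to \<open>(j + 1) * \<parallel>\<phi>\<parallel>\<^sup>2\<close> and in whose defects
  every non-simplex \<open>\<sigma>\<close> counts once for each of its facets outside \<open>S\<close>, which is at least
  \<open>j + 1 - \<beta>\<^sub>j\<close> times. So an upper bound \<open>defect \<le> c * \<parallel>\<phi>\<parallel>\<^sup>2\<close> passes from dimension \<open>j - 1\<close> to \<open>j\<close>,
  with \<open>c\<close> multiplied by \<open>(j + 1) / (j + 1 - \<beta>\<^sub>j)\<close>. It starts in dimension \<open>l\<close> with \<open>c = n - \<mu>\<^sub>l\<close>.
  A harmonic \<open>k\<close>-cochain has defect \<open>n * \<parallel>\<phi>\<parallel>\<^sup>2\<close>, so under the spectral gap it vanishes. As the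
  factors \<open>j + 1 - \<beta>\<^sub>j\<close> may be zero, the bounds are kept in multiplied-out form.
\<close>

section \<open>Operators on functions with finite support\<close>

definition funs_on :: "'b set \<Rightarrow> ('b \<Rightarrow> real) set" where
  "funs_on F = {\<phi>. \<forall>x. x \<notin> F \<longrightarrow> \<phi> x = 0}"

definition inner_on :: "'b set \<Rightarrow> ('b \<Rightarrow> real) \<Rightarrow> ('b \<Rightarrow> real) \<Rightarrow> real" where
  "inner_on F \<phi> \<psi> = (\<Sum>x\<in>F. \<phi> x * \<psi> x)"

lemma l2_eq_funs_on: "l2 S k = funs_on (simplices S k)"
  by (simp add: l2_def funs_on_def)

lemma l2_inner_eq_inner_on: "l2_inner S k = inner_on (simplices S k)"
  by (intro ext) (simp add: l2_inner_def inner_on_def)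

lemma inner_on_commute: "inner_on F \<phi> \<psi> = inner_on F \<psi> \<phi>"
  by (simp add: inner_on_def mult.commute)

lemma inner_on_add_left:
  "inner_on F (\<lambda>x. \<phi> x + \<chi> x) \<psi> = inner_on F \<phi> \<psi> + inner_on F \<chi> \<psi>"
  by (simp add: inner_on_def algebra_simps sum.distrib)

lemma inner_on_scale_left: "inner_on F (\<lambda>x. c * \<phi> x) \<psi> = c * inner_on F \<phi> \<psi>"
  by (simp add: inner_on_def sum_distrib_left mult.assoc)

lemma inner_on_diff_left:
  "inner_on F (\<lambda>x. \<phi> x - \<chi> x) \<psi> = inner_on F \<phi> \<psi> - inner_on F \<chi> \<psi>"
  by (simp add: inner_on_def algebra_simps sum_subtractf)

lemma inner_on_add_right:
  "inner_on F \<psi> (\<lambda>x. \<phi> x + \<chi> x) = inner_on F \<psi> \<phi> + inner_on F \<psi> \<chi>"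
  by (simp add: inner_on_def algebra_simps sum.distrib)

lemma inner_on_scale_right: "inner_on F \<psi> (\<lambda>x. c * \<phi> x) = c * inner_on F \<psi> \<phi>"
  by (simp add: inner_on_def sum_distrib_left mult.left_commute)

lemma inner_on_diff_right:
  "inner_on F \<psi> (\<lambda>x. \<phi> x - \<chi> x) = inner_on F \<psi> \<phi> - inner_on F \<psi> \<chi>"
  by (simp add: inner_on_def algebra_simps sum_subtractf)

lemmas inner_on_bilinear =
  inner_on_add_left inner_on_add_right inner_on_scale_left inner_on_scale_right
  inner_on_diff_left inner_on_diff_right

lemma inner_on_sum_left:
  "inner_on F (\<lambda>x. \<Sum>i\<in>I. c i * f i x) \<psi> = (\<Sum>i\<in>I. c i * inner_on F (f i) \<psi>)"
  unfolding inner_on_def sum_distrib_left sum_distrib_right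
  by (subst sum.swap) (simp add: mult.assoc)

lemma inner_on_zero_left [simp]: "inner_on F (\<lambda>x. 0) \<psi> = 0"
  by (simp add: inner_on_def)

lemma inner_on_zero_right [simp]: "inner_on F \<psi> (\<lambda>x. 0) = 0"
  by (simp add: inner_on_def)

lemma inner_on_self_nonneg: "inner_on F \<phi> \<phi> \<ge> 0"
  by (simp add: inner_on_def sum_nonneg)

lemma inner_on_self_eq_0:
  assumes "finite F" "\<phi> \<in> funs_on F" "inner_on F \<phi> \<phi> = 0"
  shows "\<phi> = (\<lambda>x. 0)"
proof -
  have "\<forall>x\<in>F. \<phi> x * \<phi> x = 0"
    using assms(1,3) unfolding inner_on_def by (subst (asm) sum_nonneg_eq_0_iff) auto
  then show ?thesis using assms(2) by (auto simp: funs_on_def)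
qed

lemma inner_on_self_pos:
  assumes "finite F" "\<phi> \<in> funs_on F" "\<phi> \<noteq> (\<lambda>x. 0)"
  shows "inner_on F \<phi> \<phi> > 0"
  using inner_on_self_eq_0[OF assms(1,2)] assms(3) inner_on_self_nonneg[of F \<phi>] by fastforce

lemma indicator_in_funs_on: "x \<in> F \<Longrightarrow> indicator {x} \<in> funs_on F"
  by (auto simp: funs_on_def indicator_def)

lemma inner_on_indicator:
  assumes "finite F" "x \<in> F"
  shows "inner_on F (indicator {x}) \<phi> = \<phi> x"
  using assms by (simp add: inner_on_def indicator_def sum.delta if_distrib[of "\<lambda>c. c * _"] cong: if_cong)

lemma funs_on_sum:
  assumes "\<And>i. i \<in> I \<Longrightarrow> f i \<in> funs_on F"
  shows "(\<lambda>x. \<Sum>i\<in>I. c i * f i x) \<in> funs_on F"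
  using assms by (auto simp: funs_on_def intro!: sum.neutral)

lemma funs_on_expand:
  assumes "finite F" "\<phi> \<in> funs_on F"
  shows "\<phi> = (\<lambda>x. \<Sum>y\<in>F. \<phi> y * indicator {y} x)"
proof
  fix x
  have "(\<Sum>y\<in>F. \<phi> y * indicator {y} x) = (\<Sum>y\<in>F. if x = y then \<phi> y else 0)"
    by (intro sum.cong) (auto simp: indicator_def)
  also have "\<dots> = \<phi> x" using assms by (auto simp: funs_on_def)
  finally show "\<phi> x = (\<Sum>y\<in>F. \<phi> y * indicator {y} x)" ..
qed

lemma linear_betweenD:
  assumes "linear_between E F T"
  shows linear_between_in: "\<phi> \<in> E \<Longrightarrow> T \<phi> \<in> F"
    and linear_between_add:
      "\<phi> \<in> E \<Longrightarrow> \<psi> \<in> E \<Longrightarrow> T (\<lambda>x. \<phi> x + \<psi> x) = (\<lambda>x. T \<phi> x + T \<psi> x)"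
    and linear_between_scale: "\<phi> \<in> E \<Longrightarrow> T (\<lambda>x. c * \<phi> x) = (\<lambda>x. c * T \<phi> x)"
  using assms by (auto simp: linear_between_def)

lemma linear_between_sum:
  assumes T: "linear_between (funs_on E) (funs_on F) T" and "finite I"
    and f: "\<And>i. i \<in> I \<Longrightarrow> f i \<in> funs_on E"
  shows "T (\<lambda>x. \<Sum>i\<in>I. c i * f i x) = (\<lambda>x. \<Sum>i\<in>I. c i * T (f i) x)"
  using \<open>finite I\<close> f
proof (induction I)
  case empty
  have "(\<lambda>x. 0) \<in> funs_on E" by (simp add: funs_on_def)
  \<comment> \<open>Homogeneity with factor 0 gives \<open>T 0 = 0\<close>; additivity takes over
    from there.\<close>
  then have "T (\<lambda>x. 0 * (0::real)) = (\<lambda>x. 0 * T (\<lambda>x. 0) x)"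
    by (rule linear_between_scale[OF T])
  then show ?case by simp
next
  case (insert i I)
  have 1: "(\<lambda>x. c i * f i x) \<in> funs_on E" using insert.prems by (auto simp: funs_on_def)
  have 2: "(\<lambda>x. \<Sum>i\<in>I. c i * f i x) \<in> funs_on E" using insert.prems by (intro funs_on_sum) auto
  have "T (\<lambda>x. \<Sum>j\<in>insert i I. c j * f j x) = T (\<lambda>x. c i * f i x + (\<Sum>i\<in>I. c i * f i x))"
    using insert.hyps by simp
  also have "\<dots> = (\<lambda>x. T (\<lambda>x. c i * f i x) x + T (\<lambda>x. \<Sum>i\<in>I. c i * f i x) x)"
    by (rule linear_between_add[OF T 1 2])
  also have "T (\<lambda>x. c i * f i x) = (\<lambda>x. c i * T (f i) x)"
    by (rule linear_between_scale[OF T]) (simp add: insert.prems)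
  finally show ?case using insert by simp
qed

lemma linear_between_expand:
  assumes "linear_between (funs_on E) (funs_on F) T" "finite E" "\<phi> \<in> funs_on E"
  shows "T \<phi> x = (\<Sum>y\<in>E. \<phi> y * T (indicator {y}) x)"
  by (subst funs_on_expand[OF assms(2,3)], subst linear_between_sum[OF assms(1,2)])
    (simp_all add: indicator_in_funs_on)

lemma linear_between_diff:
  assumes T: "linear_between (funs_on E) (funs_on F) T" and "\<phi> \<in> funs_on E" "\<psi> \<in> funs_on E"
  shows "T (\<lambda>x. \<phi> x - \<psi> x) = (\<lambda>x. T \<phi> x - T \<psi> x)"
proof -
  \<comment> \<open>The difference is a combination indexed by the two truth values, with
    coefficients 1 and -1.\<close>
  have "T (\<lambda>x. \<Sum>b\<in>UNIV. (if b then 1 else -1) * (if b then \<phi> else \<psi>) x)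
      = (\<lambda>x. \<Sum>b\<in>UNIV. (if b then 1 else -1) * T (if b then \<phi> else \<psi>) x)"
    using assms by (intro linear_between_sum[OF T]) auto
  then show ?thesis by (simp add: UNIV_bool)
qed

lemma linear_between_zero:
  assumes "linear_between (funs_on E) (funs_on F) T"
  shows "T (\<lambda>x. 0) = (\<lambda>x. 0)"
  using linear_between_sum[OF assms, of "{}"] by simp

section \<open>Orthonormal sets and orthogonal projection\<close>

text \<open>The squared norm of \<open>\<phi> - p\<close> is nonnegative, where \<open>p\<close> is
  the orthogonal projection of \<open>\<phi>\<close> to the span of \<open>B\<close>.\<close>

lemma bessel_inequality:
  assumes "finite B" and on: "\<And>b c. b \<in> B \<Longrightarrow> c \<in> B \<Longrightarrow> inner_on F b c = of_bool (b = c)"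
  shows "(\<Sum>b\<in>B. (inner_on F \<phi> b)\<^sup>2) \<le> inner_on F \<phi> \<phi>"
proof -
  define p where "p = (\<lambda>x. \<Sum>b\<in>B. inner_on F \<phi> b * b x)"
  have p\<phi>: "inner_on F p \<phi> = (\<Sum>b\<in>B. (inner_on F \<phi> b)\<^sup>2)"
    unfolding p_def inner_on_sum_left by (simp add: power2_eq_square inner_on_commute)
  have pb: "inner_on F p b = inner_on F \<phi> b" if "b \<in> B" for b
  proof -
    have "inner_on F p b = (\<Sum>c\<in>B. inner_on F \<phi> c * of_bool (c = b))"
      unfolding p_def inner_on_sum_left using that by (intro sum.cong) (auto simp: on)
    also have "\<dots> = inner_on F \<phi> b" using that \<open>finite B\<close> by (simp add: of_bool_def if_distrib sum.delta cong: if_cong)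
    finally show ?thesis .
  qed
  have pp: "inner_on F p p = (\<Sum>b\<in>B. (inner_on F \<phi> b)\<^sup>2)"
    by (subst (1) p_def, unfold inner_on_sum_left)
      (simp add: power2_eq_square pb[unfolded inner_on_commute[of F p]])
  have "0 \<le> inner_on F (\<lambda>x. \<phi> x - p x) (\<lambda>x. \<phi> x - p x)" by (rule inner_on_self_nonneg)
  also have "\<dots> = inner_on F \<phi> \<phi> - 2 * inner_on F p \<phi> + inner_on F p p"
    using inner_on_commute[of F \<phi> p] by (simp add: inner_on_bilinear)
  finally show ?thesis by (simp add: p\<phi> pp)
qed

text \<open>The squared norms of the members of \<open>B\<close> add up to \<open>card B\<close>.
  Sorted by coordinate, the contribution of each \<open>x\<close> is at most 1, by Bessel's
  inequality for the unit vector at \<open>x\<close>.\<close>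

lemma card_orthonormal_le:
  assumes "finite F" "finite B"
    and on: "\<And>b c. b \<in> B \<Longrightarrow> c \<in> B \<Longrightarrow> inner_on F b c = of_bool (b = c)"
  shows "card B \<le> card F"
proof -
  have "real (card B) = (\<Sum>b\<in>B. inner_on F b b)" by (simp add: on)
  also have "\<dots> = (\<Sum>x\<in>F. \<Sum>b\<in>B. (b x)\<^sup>2)"
    unfolding inner_on_def power2_eq_square by (rule sum.swap)
  also have "\<dots> \<le> (\<Sum>x\<in>F. 1)"
  proof (rule sum_mono)
    fix x assume x: "x \<in> F"
    have "(\<Sum>b\<in>B. (b x)\<^sup>2) = (\<Sum>b\<in>B. (inner_on F (indicator {x}) b)\<^sup>2)"
      by (simp add: inner_on_indicator[OF \<open>finite F\<close> x])
    also have "\<dots> \<le> inner_on F (indicator {x}) (indicator {x})"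
      by (rule bessel_inequality[OF \<open>finite B\<close> on])
    also have "\<dots> = 1" by (simp add: inner_on_indicator[OF \<open>finite F\<close> x])
    finally show "(\<Sum>b\<in>B. (b x)\<^sup>2) \<le> 1" .
  qed
  finally show ?thesis by simp
qed

text \<open>A maximal orthonormal subset of the range of \<open>T\<close> spans it.\<close>

lemma orthogonal_projection_range:
  assumes fin: "finite E" "finite F" and T: "linear_between (funs_on E) (funs_on F) T"
  obtains w where "w \<in> funs_on E"
    "\<And>v. v \<in> funs_on E \<Longrightarrow> inner_on F (\<lambda>x. \<phi> x - T w x) (T v) = 0"
proof -
  define W where "W = T ` funs_on E"
  define ortho where "ortho = (\<lambda>B. finite B \<and> B \<subseteq> W \<and>
    (\<forall>b\<in>B. \<forall>c\<in>B. inner_on F b c = of_bool (b = c)))"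
  \<comment> \<open>A largest orthonormal subset of the range exists because \<open>card F\<close>
    bounds the size of all of them.\<close>
  have "ortho {}" by (simp add: ortho_def)
  moreover have "\<forall>B. ortho B \<longrightarrow> card B < Suc (card F)"
    using card_orthonormal_le[OF \<open>finite F\<close>] by (auto simp: ortho_def less_Suc_eq_le)
  ultimately obtain B where B: "ortho B" and max: "\<And>C. ortho C \<Longrightarrow> card C \<le> card B"
    using ex_has_greatest_nat[of ortho "{}" card "Suc (card F)"] by auto
  have fB: "finite B" and BW: "B \<subseteq> W"
    and on: "\<And>b c. b \<in> B \<Longrightarrow> c \<in> B \<Longrightarrow> inner_on F b c = of_bool (b = c)"
    using B by (auto simp: ortho_def)
  define q where "q = (\<lambda>b. SOME v. v \<in> funs_on E \<and> T v = b)"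
  have q: "q b \<in> funs_on E" "T (q b) = b" if "b \<in> B" for b
    using someI_ex[of "\<lambda>v. v \<in> funs_on E \<and> T v = b"] that BW by (auto simp: W_def q_def)
  \<comment> \<open>\<open>w \<psi>\<close> is a preimage under \<open>T\<close> of the projection
    of \<open>\<psi>\<close> to the span of \<open>B\<close>. It is kept as a function of
    \<open>\<psi>\<close> since it serves both for \<open>\<phi>\<close> and for the vectors
    \<open>T v\<close>.\<close>
  define w where "w = (\<lambda>\<psi> x. \<Sum>b\<in>B. inner_on F \<psi> b * q b x)"
  have w: "w \<psi> \<in> funs_on E" for \<psi> unfolding w_def by (intro funs_on_sum q)
  have Tw: "T (w \<psi>) = (\<lambda>x. \<Sum>b\<in>B. inner_on F \<psi> b * b x)" for \<psi>
    unfolding w_def by (subst linear_between_sum[OF T fB]) (auto simp: q)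
  have perp: "inner_on F (\<lambda>x. \<psi> x - T (w \<psi>) x) c = 0" if "c \<in> B" for \<psi> c
  proof -
    have "inner_on F (T (w \<psi>)) c = (\<Sum>b\<in>B. inner_on F \<psi> b * of_bool (b = c))"
      unfolding Tw inner_on_sum_left using that by (intro sum.cong) (auto simp: on)
    also have "\<dots> = inner_on F \<psi> c"
      using that fB by (simp add: of_bool_def if_distrib sum.delta cong: if_cong)
    finally show ?thesis by (simp add: inner_on_diff_left)
  qed
  have span: "T v = T (w (T v))" if v: "v \<in> funs_on E" for v
  proof (rule ccontr)
    \<comment> \<open>A nonzero residual \<open>r\<close> of \<open>T v\<close> lies in the range
      and is orthogonal to \<open>B\<close>; after normalisation it would enlarge
      \<open>B\<close>.\<close>
    assume ne: "T v \<noteq> T (w (T v))"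
    define r where "r = (\<lambda>x. T v x - T (w (T v)) x)"
    have r: "r = T (\<lambda>x. v x - w (T v) x)"
      unfolding r_def by (rule linear_between_diff[OF T v w, symmetric])
    have vw: "(\<lambda>x. v x - w (T v) x) \<in> funs_on E" using v w[of "T v"] by (auto simp: funs_on_def)
    have rF: "r \<in> funs_on F" unfolding r by (rule linear_between_in[OF T vw])
    have "r \<noteq> (\<lambda>x. 0)" using ne unfolding r_def by (auto simp: fun_eq_iff)
    then have pos: "inner_on F r r > 0"
      by (rule inner_on_self_pos[OF \<open>finite F\<close> rF])
    define c where "c = 1 / sqrt (inner_on F r r)"
    define e where "e = (\<lambda>x. c * r x)"
    have "e = T (\<lambda>x. c * (v x - w (T v) x))"
      unfolding e_def r by (rule linear_between_scale[OF T vw, symmetric])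
    moreover have "(\<lambda>x. c * (v x - w (T v) x)) \<in> funs_on E" using vw by (auto simp: funs_on_def)
    ultimately have eW: "e \<in> W" unfolding W_def by (rule image_eqI)
    have ee: "inner_on F e e = 1"
      unfolding e_def inner_on_bilinear using pos by (simp add: c_def)
    have eb: "inner_on F e b = 0" if "b \<in> B" for b
      using perp[OF that, of "T v"] by (simp add: e_def inner_on_scale_left r_def)
    have be: "inner_on F b e = 0" if "b \<in> B" for b
      using eb[OF that] by (simp add: inner_on_commute[of F b e])
    have "e \<notin> B" using eb ee by auto
    moreover have "ortho (insert e B)"
      using fB BW on eW ee eb \<open>e \<notin> B\<close> by (auto simp: ortho_def be)
    ultimately show False using max[of "insert e B"] fB by simp
  qed
  show ?thesis
  proof (rule that[of "w \<phi>"])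
    fix v assume "v \<in> funs_on E"
    then have Tv: "T v = (\<lambda>x. \<Sum>b\<in>B. inner_on F (T v) b * b x)"
      using span Tw by simp
    have "inner_on F (T v) (\<lambda>x. \<phi> x - T (w \<phi>) x)
        = (\<Sum>b\<in>B. inner_on F (T v) b * inner_on F b (\<lambda>x. \<phi> x - T (w \<phi>) x))"
      by (subst Tv) (rule inner_on_sum_left)
    also have "\<dots> = 0"
      by (intro sum.neutral ballI) (subst inner_on_commute, simp add: perp)
    finally show "inner_on F (\<lambda>x. \<phi> x - T (w \<phi>) x) (T v) = 0"
      by (subst inner_on_commute)
  qed (rule w)
qed

section \<open>Spectrum and Rayleigh bound of a symmetric operator\<close>

text \<open>Linearity and symmetry are asked on \<open>funs_on F\<close> only:
  \<open>boundary\<close>, and with it the Hodge Laplacian, is unspecified on other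
  functions.\<close>

locale symmetric_operator =
  fixes F :: "'b set" and A :: "('b \<Rightarrow> real) \<Rightarrow> 'b \<Rightarrow> real"
  assumes finite: "finite F"
    and linear: "linear_between (funs_on F) (funs_on F) A"
    and symmetric: "\<phi> \<in> funs_on F \<Longrightarrow> \<psi> \<in> funs_on F \<Longrightarrow> inner_on F (A \<phi>) \<psi> = inner_on F \<phi> (A \<psi>)"
begin

text \<open>\<open>Min\<close> is meaningful only on a finite set. By symmetry, unit eigenvectors of
  distinct eigenvalues are orthonormal, so there are at most \<open>card F\<close>
  eigenvalues.\<close>

lemma finite_spectrum: "finite (spectrum_on (funs_on F) A)"
proof -
  define ev where "ev = (\<lambda>r. SOME \<phi>. \<phi> \<in> funs_on F \<and> inner_on F \<phi> \<phi> = 1 \<and> A \<phi> = (\<lambda>x. r * \<phi> x))"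
  have ev: "ev r \<in> funs_on F \<and> inner_on F (ev r) (ev r) = 1 \<and> A (ev r) = (\<lambda>x. r * ev r x)"
    if "r \<in> spectrum_on (funs_on F) A" for r
  proof -
    from that obtain \<phi> where \<phi>: "\<phi> \<in> funs_on F" "\<phi> \<noteq> (\<lambda>x. 0)" "A \<phi> = (\<lambda>x. r * \<phi> x)"
      by (auto simp: spectrum_on_def)
    have pos: "inner_on F \<phi> \<phi> > 0"
      by (rule inner_on_self_pos[OF finite \<phi>(1,2)])
    define c where "c = 1 / sqrt (inner_on F \<phi> \<phi>)"
    have "A (\<lambda>x. c * \<phi> x) = (\<lambda>x. c * A \<phi> x)"
      by (rule linear_between_scale[OF linear \<phi>(1)])
    moreover have "inner_on F (\<lambda>x. c * \<phi> x) (\<lambda>x. c * \<phi> x) = 1"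
      unfolding inner_on_bilinear using pos by (simp add: c_def)
    moreover have "(\<lambda>x. c * A \<phi> x) = (\<lambda>x. r * (c * \<phi> x))"
      unfolding \<phi>(3) by (simp add: mult.left_commute)
    moreover have "(\<lambda>x. c * \<phi> x) \<in> funs_on F" using \<phi>(1) by (simp add: funs_on_def)
    ultimately have "\<exists>\<phi>. \<phi> \<in> funs_on F \<and> inner_on F \<phi> \<phi> = 1 \<and> A \<phi> = (\<lambda>x. r * \<phi> x)"
      by (intro exI[of _ "\<lambda>x. c * \<phi> x"] conjI) simp_all
    then show ?thesis unfolding ev_def by (rule someI_ex)
  qed
  have on: "inner_on F (ev r) (ev t) = of_bool (r = t)"
    if "r \<in> spectrum_on (funs_on F) A" "t \<in> spectrum_on (funs_on F) A" for r t
  proof (cases "r = t")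
    case False
    have "r * inner_on F (ev r) (ev t) = inner_on F (A (ev r)) (ev t)"
      using ev[OF that(1)] by (simp add: inner_on_scale_left)
    also have "\<dots> = inner_on F (A (ev t)) (ev r)"
      using symmetric[of "ev r" "ev t"] ev[OF that(1)] ev[OF that(2)]
        inner_on_commute[of F "ev r" "A (ev t)"] by argo
    also have "\<dots> = t * inner_on F (ev r) (ev t)"
      using ev[OF that(2)] by (simp add: inner_on_scale_left inner_on_commute[of F "ev t" "ev r"])
    finally show ?thesis using False by simp
  next
    case True
    then show ?thesis using ev[OF that(1)] by simp
  qed
  have "card G \<le> card F" if "G \<subseteq> spectrum_on (funs_on F) A" "finite G" for G
  proof -
    have inj: "inj_on ev G"
    proof (rule inj_onI)
      fix r t assume "r \<in> G" "t \<in> G" "ev r = ev t"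
      then have "of_bool (r = t) = (1 :: real)"
        using on[of r t] on[of r r] that(1) by auto
      then show "r = t" by simp
    qed
    have "card (ev ` G) \<le> card F"
      using that on inj by (intro card_orthonormal_le finite) (auto simp: inj_on_eq_iff subset_iff)
    then show ?thesis using card_image[OF inj] by simp
  qed
  then show ?thesis using finite_if_finite_subsets_card_bdd by blast
qed

text \<open>The quadratic form attains its minimum on the compact unit sphere, and a variation at
  the minimiser \<open>\<eta>\<close> in the direction of the residual of the eigenvalue equation
  shows that \<open>\<eta>\<close> is an eigenvector.\<close>

lemma rayleigh:
  assumes "F \<noteq> {}"
  obtains m where "m \<in> spectrum_on (funs_on F) A"
    "\<And>\<phi>. \<phi> \<in> funs_on F \<Longrightarrow> m * inner_on F \<phi> \<phi> \<le> inner_on F (A \<phi>) \<phi>"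
proof -
  \<comment> \<open>The ambient type carries the product topology, so compactness comes from
    Tychonoff: the coordinates outside \<open>F\<close> are pinned to 0. The cube contains every
    unit vector of \<open>funs_on F\<close>.\<close>
  define K where "K = (\<Pi>\<^sub>E x\<in>UNIV. if x \<in> F then {-1..1} else {0::real})"
  \<comment> \<open>The form is written through the matrix entries of \<open>A\<close>, which makes
    it a polynomial in the coordinates and thus continuous on \<open>K\<close>.\<close>
  define g where "g = (\<lambda>\<phi>. inner_on F (\<lambda>x. \<Sum>y\<in>F. \<phi> y * A (indicator {y}) x) \<phi>)"
  have gA: "g \<phi> = inner_on F (A \<phi>) \<phi>" if "\<phi> \<in> funs_on F" for \<phi>
    unfolding g_def using linear_between_expand[OF linear finite that] by presburger
  have "compactin (product_topology (\<lambda>x. euclidean) UNIV) K"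
    unfolding K_def by (subst compactin_PiE) auto
  then have K: "compact K" by (simp add: euclidean_product_topology)
  have cont_norm: "continuous_on K (\<lambda>\<phi>. inner_on F \<phi> \<phi>)"
    unfolding inner_on_def
    by (intro continuous_intros continuous_on_subset[OF continuous_on_product_coordinates]) auto
  have "closedin (top_of_set K) (K \<inter> (\<lambda>\<phi>. inner_on F \<phi> \<phi>) -` {1})"
    by (intro continuous_closedin_preimage cont_norm) auto
  then have sphere: "compact (K \<inter> (\<lambda>\<phi>. inner_on F \<phi> \<phi>) -` {1})"
    using K closedin_compact by blast
  obtain x where x: "x \<in> F" using assms by blast
  have ind: "(indicator {x} :: _ \<Rightarrow> real) \<in> K \<inter> (\<lambda>\<phi>. inner_on F \<phi> \<phi>) -` {1}"
  proof -
    have "inner_on F (indicator {x}) (indicator {x} :: _ \<Rightarrow> real) = 1"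
      by (simp add: inner_on_indicator[OF finite x])
    moreover have "(indicator {x} :: _ \<Rightarrow> real) \<in> K"
      using x by (auto simp: K_def indicator_def)
    ultimately show ?thesis by simp
  qed
  have "continuous_on K g"
    unfolding g_def inner_on_def
    by (intro continuous_intros continuous_on_subset[OF continuous_on_product_coordinates]) auto
  then have "continuous_on (K \<inter> (\<lambda>\<phi>. inner_on F \<phi> \<phi>) -` {1}) g"
    by (rule continuous_on_subset) auto
  from continuous_attains_inf[OF sphere _ this] ind
  obtain \<eta> where \<eta>: "\<eta> \<in> K" "inner_on F \<eta> \<eta> = 1"
    and min: "\<And>\<phi>. \<phi> \<in> K \<Longrightarrow> inner_on F \<phi> \<phi> = 1 \<Longrightarrow> g \<eta> \<le> g \<phi>"
    by (metis (no_types, lifting) IntE IntI empty_iff vimage_singleton_eq)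
  have \<eta>F: "\<eta> \<in> funs_on F"
    using \<eta>(1) by (auto simp: K_def funs_on_def PiE_iff split: if_splits)
  have bound: "g \<eta> * inner_on F \<phi> \<phi> \<le> inner_on F (A \<phi>) \<phi>" if \<phi>: "\<phi> \<in> funs_on F" for \<phi>
  proof (cases "\<phi> = (\<lambda>x. 0)")
    case False
    then have pos: "inner_on F \<phi> \<phi> > 0"
      by (rule inner_on_self_pos[OF finite \<phi>])
    define c where "c = 1 / sqrt (inner_on F \<phi> \<phi>)"
    define \<psi> where "\<psi> = (\<lambda>x. c * \<phi> x)"
    have cc: "c * c * inner_on F \<phi> \<phi> = 1" using pos by (simp add: c_def)
    have \<psi>1: "inner_on F \<psi> \<psi> = 1"
      using cc by (simp add: \<psi>_def inner_on_bilinear)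
    have \<psi>F: "\<psi> \<in> funs_on F" using \<phi> by (auto simp: \<psi>_def funs_on_def)
    have "\<psi> y \<in> {-1..1}" if "y \<in> F" for y
    proof -
      have "\<psi> y * \<psi> y \<le> 1"
        unfolding \<psi>1[symmetric] inner_on_def using that finite
        by (intro member_le_sum) auto
      then show ?thesis using abs_square_le_1[of "\<psi> y"] by (simp add: power2_eq_square abs_le_iff)
    qed
    then have "\<psi> \<in> K" using \<psi>F by (auto simp: K_def funs_on_def)
    then have "g \<eta> \<le> g \<psi>" using min \<psi>1 by simp
    also have "g \<psi> = c * c * inner_on F (A \<phi>) \<phi>"
    proof -
      have "A \<psi> = (\<lambda>x. c * A \<phi> x)"
        unfolding \<psi>_def by (rule linear_between_scale[OF linear \<phi>])
      then show ?thesis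
        unfolding gA[OF \<psi>F] by (simp add: \<psi>_def inner_on_bilinear)
    qed
    also have "\<dots> = inner_on F (A \<phi>) \<phi> / inner_on F \<phi> \<phi>"
      using pos by (simp add: c_def)
    finally show ?thesis using pos by (simp add: field_simps)
  qed simp
  define r where "r = (\<lambda>x. A \<eta> x - g \<eta> * \<eta> x)"
  have A\<eta>: "A \<eta> \<in> funs_on F" by (rule linear_between_in[OF linear \<eta>F])
  then have rF: "r \<in> funs_on F" using \<eta>F by (auto simp: r_def funs_on_def)
  have Ar: "A r \<in> funs_on F" by (rule linear_between_in[OF linear rF])
  text \<open>The derivative of the nonnegative form at its minimiser \<open>\<eta>\<close> in the direction \<open>r\<close>
    is \<open>2 * inner_on F r r\<close>, so \<open>r\<close> vanishes.\<close>
  have quad: "0 \<le> 2 * t * inner_on F r r + t * t * (inner_on F (A r) r - g \<eta> * inner_on F r r)" for t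
  proof -
    define \<phi> where "\<phi> = (\<lambda>x. \<eta> x + t * r x)"
    have \<phi>: "\<phi> \<in> funs_on F" using \<eta>F rF by (auto simp: \<phi>_def funs_on_def)
    have tr: "(\<lambda>x. t * r x) \<in> funs_on F" using rF by (auto simp: funs_on_def)
    have "A \<phi> = (\<lambda>x. A \<eta> x + A (\<lambda>x. t * r x) x)"
      unfolding \<phi>_def by (rule linear_between_add[OF linear \<eta>F tr])
    also have "A (\<lambda>x. t * r x) = (\<lambda>x. t * A r x)"
      by (rule linear_between_scale[OF linear rF])
    finally have A\<phi>: "A \<phi> = (\<lambda>x. A \<eta> x + t * A r x)" .
    have rr: "inner_on F r r = inner_on F (A \<eta>) r - g \<eta> * inner_on F \<eta> r"
      by (subst (1) r_def) (simp add: inner_on_diff_left inner_on_scale_left)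
    have "inner_on F (A \<phi>) \<phi> = g \<eta> + 2 * t * inner_on F (A \<eta>) r + t * t * inner_on F (A r) r"
      unfolding A\<phi> gA[OF \<eta>F]
      using symmetric[OF rF \<eta>F] inner_on_commute[of F r "A \<eta>"]
      by (simp add: \<phi>_def[THEN arg_cong[where f = "inner_on F _"]] inner_on_bilinear algebra_simps)
    moreover have "inner_on F \<phi> \<phi> = 1 + 2 * t * inner_on F \<eta> r + t * t * inner_on F r r"
      unfolding \<phi>_def using \<eta>(2) inner_on_commute[of F r \<eta>]
      by (simp add: inner_on_bilinear algebra_simps)
    ultimately have "inner_on F (A \<phi>) \<phi> - g \<eta> * inner_on F \<phi> \<phi> =
        2 * t * (inner_on F (A \<eta>) r - g \<eta> * inner_on F \<eta> r)
        + t * t * (inner_on F (A r) r - g \<eta> * inner_on F r r)"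
      by (simp only:) (simp add: algebra_simps)
    then show ?thesis using bound[OF \<phi>] unfolding rr[symmetric] by linarith
  qed
  have "inner_on F r r = 0"
  proof (rule ccontr)
    define a where "a = inner_on F r r"
    define b where "b = inner_on F (A r) r - g \<eta> * inner_on F r r"
    assume "inner_on F r r \<noteq> 0"
    then have a: "a > 0" using inner_on_self_nonneg[of F r] by (simp add: a_def)
    have q: "0 \<le> 2 * t * a + t * t * b" for t using quad unfolding a_def b_def .
    \<comment> \<open>This negative \<open>t\<close> is small enough that the quadratic term cannot
      compensate the linear one: \<open>t * b \<ge> - a\<close> makes \<open>2 * a + t * b\<close>
      positive.\<close>
    define t where "t = - a / (\<bar>b\<bar> + 1)"
    have "t < 0" using a by (simp add: t_def field_simps)
    moreover have "0 \<le> t * (2 * a + t * b)" using q[of t] by (simp add: algebra_simps)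
    ultimately have "2 * a + t * b \<le> 0" by (simp add: zero_le_mult_iff)
    moreover have "t * b \<ge> - a"
    proof -
      have "a * b \<le> a * (\<bar>b\<bar> + 1)" using a by (intro mult_left_mono) auto
      then show ?thesis by (simp add: t_def field_simps)
    qed
    ultimately show False using a by simp
  qed
  then have "r = (\<lambda>x. 0)" by (rule inner_on_self_eq_0[OF finite rF])
  then have "A \<eta> = (\<lambda>x. g \<eta> * \<eta> x)" by (simp add: r_def fun_eq_iff)
  moreover have "\<eta> \<noteq> (\<lambda>x. 0)" using \<eta>(2) by auto
  ultimately have "g \<eta> \<in> spectrum_on (funs_on F) A" using \<eta>F by (auto simp: spectrum_on_def)
  from this bound show ?thesis by (rule that)
qed

corollary Min_spectrum_le:
  assumes "\<phi> \<in> funs_on F"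
  shows "Min (spectrum_on (funs_on F) A) * inner_on F \<phi> \<phi> \<le> inner_on F (A \<phi>) \<phi>"
proof (cases "F = {}")
  \<comment> \<open>The spectrum is empty here and its \<open>Min\<close> arbitrary, but both sides
    are 0.\<close>
  case True
  then show ?thesis by (simp add: inner_on_def)
next
  case False
  show ?thesis
  proof (rule rayleigh[OF False])
    fix m assume m: "m \<in> spectrum_on (funs_on F) A"
      "\<And>\<phi>. \<phi> \<in> funs_on F \<Longrightarrow> m * inner_on F \<phi> \<phi> \<le> inner_on F (A \<phi>) \<phi>"
    have "Min (spectrum_on (funs_on F) A) * inner_on F \<phi> \<phi> \<le> m * inner_on F \<phi> \<phi>"
      using finite_spectrum m(1) by (intro mult_right_mono Min_le inner_on_self_nonneg)
    also have "\<dots> \<le> inner_on F (A \<phi>) \<phi>" by (rule m(2)[OF assms])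
    finally show ?thesis .
  qed
qed

end

section \<open>Cochains of the complete complex\<close>

text \<open>\<open>s \<tau> \<sigma>\<close> is the matrix entry of the coboundary for a facet
  \<open>\<tau>\<close> of \<open>\<sigma>\<close>. The cocycle axiom is the vanishing of the
  squared coboundary between \<open>\<rho>\<close> and \<open>\<rho>\<close> with two vertices
  added, where exactly two intermediate faces contribute.\<close>

locale incidence_signs =
  fixes V :: "'a set" and s :: "'a set \<Rightarrow> 'a set \<Rightarrow> real"
  assumes finite_V: "finite V"
    and sign_square: "\<sigma> \<subseteq> V \<Longrightarrow> v \<in> \<sigma> \<Longrightarrow> s (\<sigma> - {v}) \<sigma> * s (\<sigma> - {v}) \<sigma> = 1"
    and sign_cocycle: "\<rho> \<subseteq> V \<Longrightarrow> u \<in> V - \<rho> \<Longrightarrow> v \<in> V - \<rho> \<Longrightarrow> u \<noteq> v \<Longrightarrow>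
      s \<rho> (insert u \<rho>) * s (insert u \<rho>) (insert u (insert v \<rho>)) +
      s \<rho> (insert v \<rho>) * s (insert v \<rho>) (insert u (insert v \<rho>)) = 0"
begin

text \<open>Ungraded: one operator acts on functions on all subsets, so no dimension has to be
  carried along.\<close>

definition cobd :: "('a set \<Rightarrow> real) \<Rightarrow> 'a set \<Rightarrow> real" where
  "cobd \<phi> \<sigma> = (\<Sum>v\<in>\<sigma>. s (\<sigma> - {v}) \<sigma> * \<phi> (\<sigma> - {v}))"

definition bd :: "('a set \<Rightarrow> real) \<Rightarrow> 'a set \<Rightarrow> real" where
  "bd \<phi> \<tau> = (\<Sum>u\<in>V - \<tau>. s \<tau> (insert u \<tau>) * \<phi> (insert u \<tau>))"

text \<open>Contraction of a cochain with the vertex \<open>u\<close>. The sign factor makes it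
  anticommute with \<open>cobd\<close> up to one term; outside \<open>Pow V\<close> the value is 0,
  as membership in \<open>l2\<close> requires.\<close>

definition link :: "'a \<Rightarrow> ('a set \<Rightarrow> real) \<Rightarrow> 'a set \<Rightarrow> real" where
  "link u \<phi> \<tau> = (if u \<in> \<tau> \<or> \<not> \<tau> \<subseteq> V then 0 else s \<tau> (insert u \<tau>) * \<phi> (insert u \<tau>))"

definition defect :: "'a set set \<Rightarrow> ('a set \<Rightarrow> real) \<Rightarrow> real" where
  "defect S \<phi> = (\<Sum>\<sigma>\<in>Pow V - S. (cobd \<phi> \<sigma>)\<^sup>2)"

lemma finite_subset_V: "\<sigma> \<subseteq> V \<Longrightarrow> finite \<sigma>"
  using finite_V finite_subset by blast

lemma sign_square_insert:
  assumes "\<tau> \<subseteq> V" "u \<in> V - \<tau>"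
  shows "s \<tau> (insert u \<tau>) * s \<tau> (insert u \<tau>) = 1"
  using sign_square[of "insert u \<tau>" u] assms by auto

text \<open>Both sides run over the pairs of a face and one of its facets, listed by the facet and
  the added vertex or by the face and the removed one.\<close>

lemma sum_flags_swap:
  fixes f :: "'a set \<Rightarrow> 'a \<Rightarrow> real"
  shows "(\<Sum>\<tau>\<in>Pow V. \<Sum>u\<in>V - \<tau>. f \<tau> u) = (\<Sum>\<sigma>\<in>Pow V. \<Sum>v\<in>\<sigma>. f (\<sigma> - {v}) v)"
proof -
  have "(\<Sum>\<tau>\<in>Pow V. \<Sum>u\<in>V - \<tau>. f \<tau> u) = (\<Sum>(\<tau>, u)\<in>Sigma (Pow V) (\<lambda>\<tau>. V - \<tau>). f \<tau> u)"
    using finite_V by (subst sum.Sigma) auto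
  also have "\<dots> = (\<Sum>(\<sigma>, v)\<in>Sigma (Pow V) (\<lambda>\<sigma>. \<sigma>). f (\<sigma> - {v}) v)"
    by (rule sum.reindex_bij_witness[of _ "\<lambda>(\<sigma>, v). (\<sigma> - {v}, v)" "\<lambda>(\<tau>, u). (insert u \<tau>, u)"])
      auto
  also have "\<dots> = (\<Sum>\<sigma>\<in>Pow V. \<Sum>v\<in>\<sigma>. f (\<sigma> - {v}) v)"
    using finite_V finite_subset_V by (subst sum.Sigma) auto
  finally show ?thesis .
qed

lemma bd_cobd_adjoint: "inner_on (Pow V) (bd \<psi>) \<phi> = inner_on (Pow V) \<psi> (cobd \<phi>)"
proof -
  have "inner_on (Pow V) (bd \<psi>) \<phi> =
      (\<Sum>\<tau>\<in>Pow V. \<Sum>u\<in>V - \<tau>. s \<tau> (insert u \<tau>) * \<psi> (insert u \<tau>) * \<phi> \<tau>)"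
    unfolding inner_on_def bd_def by (simp add: sum_distrib_right)
  also have "\<dots> = (\<Sum>\<sigma>\<in>Pow V. \<Sum>v\<in>\<sigma>.
      s (\<sigma> - {v}) (insert v (\<sigma> - {v})) * \<psi> (insert v (\<sigma> - {v})) * \<phi> (\<sigma> - {v}))"
    by (rule sum_flags_swap)
  also have "\<dots> = inner_on (Pow V) \<psi> (cobd \<phi>)"
    unfolding inner_on_def cobd_def
    by (intro sum.cong) (auto simp: sum_distrib_left insert_absorb intro!: sum.cong)
  finally show ?thesis .
qed

text \<open>With \<open>\<rho> = \<tau> - {v}\<close>, the faces \<open>\<rho>\<close>,
  \<open>\<tau>\<close>, \<open>insert u \<rho>\<close>, \<open>insert u \<tau>\<close> form a
  square. By the cocycle relation and since all signs square to 1, its four signs multiply to -1;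
  the two upper ones are on the left, the two lower ones on the right.\<close>

lemma sign_exchange:
  assumes "\<tau> \<subseteq> V" "v \<in> \<tau>" "u \<in> V - \<tau>"
  shows "s \<tau> (insert u \<tau>) * s (insert u (\<tau> - {v})) (insert u \<tau>) =
    - (s (\<tau> - {v}) \<tau> * s (\<tau> - {v}) (insert u (\<tau> - {v})))"
proof -
  define \<rho> where "\<rho> = \<tau> - {v}"
  have \<tau>: "\<tau> = insert v \<rho>" using assms by (auto simp: \<rho>_def)
  have \<rho>: "\<rho> \<subseteq> V" "u \<in> V - \<rho>" "v \<in> V - \<rho>" "u \<noteq> v" using assms by (auto simp: \<rho>_def)
  have 1: "s \<rho> (insert u \<rho>) * s (insert u \<rho>) (insert u \<tau>) + s \<rho> \<tau> * s \<tau> (insert u \<tau>) = 0"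
    using sign_cocycle[OF \<rho>] unfolding \<tau> .
  have 2: "s \<rho> \<tau> * s \<rho> \<tau> = 1" using sign_square[of \<tau> v] assms by (simp add: \<rho>_def)
  have 3: "s \<rho> (insert u \<rho>) * s \<rho> (insert u \<rho>) = 1" by (rule sign_square_insert[OF \<rho>(1,2)])
  have "s \<tau> (insert u \<tau>) * s (insert u \<rho>) (insert u \<tau>)
      = - (s \<rho> \<tau> * s \<rho> (insert u \<rho>)) * (s (insert u \<rho>) (insert u \<tau>) * s (insert u \<rho>) (insert u \<tau>))"
    using 1 2 by algebra
  also have "s (insert u \<rho>) (insert u \<tau>) * s (insert u \<rho>) (insert u \<tau>) = 1"
  proof -
    have "insert u \<tau> - {v} = insert u \<rho>" using \<rho>(4) by (auto simp: \<rho>_def)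
    then show ?thesis using sign_square[of "insert u \<tau>" v] assms by auto
  qed
  finally show ?thesis by (simp add: \<rho>_def)
qed

text \<open>On the complete complex the Laplacian is multiplication by the number of vertices: by the
  cocycle relation the off-diagonal entries of its two summands cancel.\<close>

lemma bd_cobd_plus_cobd_bd:
  assumes \<tau>: "\<tau> \<subseteq> V"
  shows "bd (cobd \<phi>) \<tau> + cobd (bd \<phi>) \<tau> = real (card V) * \<phi> \<tau>"
proof -
  have fin: "finite \<tau>" by (rule finite_subset_V[OF \<tau>])
  \<comment> \<open>The term of the face that exchanges \<open>v\<close> for \<open>u\<close> in
    \<open>\<tau>\<close>. It enters \<open>bd (cobd \<phi>)\<close> with a minus sign, by
    \<open>sign_exchange\<close>, and \<open>cobd (bd \<phi>)\<close> with a plus sign. The diagonal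
    terms number \<open>card (V - \<tau>)\<close> and \<open>card \<tau>\<close>.\<close>
  define h where "h = (\<lambda>u v. s (\<tau> - {v}) \<tau> * s (\<tau> - {v}) (insert u (\<tau> - {v})) * \<phi> (insert u (\<tau> - {v})))"
  have "bd (cobd \<phi>) \<tau> = (\<Sum>u\<in>V - \<tau>. \<phi> \<tau> - (\<Sum>v\<in>\<tau>. h u v))"
    unfolding bd_def
  proof (rule sum.cong)
    fix u assume u: "u \<in> V - \<tau>"
    have "cobd \<phi> (insert u \<tau>) = s \<tau> (insert u \<tau>) * \<phi> \<tau> +
        (\<Sum>v\<in>\<tau>. s (insert u (\<tau> - {v})) (insert u \<tau>) * \<phi> (insert u (\<tau> - {v})))"
      unfolding cobd_def using u fin by (simp add: insert_Diff_if) (intro sum.cong; auto)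
    then have "s \<tau> (insert u \<tau>) * cobd \<phi> (insert u \<tau>) = s \<tau> (insert u \<tau>) * s \<tau> (insert u \<tau>) * \<phi> \<tau> +
        (\<Sum>v\<in>\<tau>. s \<tau> (insert u \<tau>) * s (insert u (\<tau> - {v})) (insert u \<tau>) * \<phi> (insert u (\<tau> - {v})))"
      by (simp add: distrib_left sum_distrib_left mult.assoc)
    also have "\<dots> = \<phi> \<tau> + (\<Sum>v\<in>\<tau>. - h u v)"
      unfolding sign_square_insert[OF \<tau> u] h_def using \<tau> u by (simp add: sign_exchange)
    finally show "s \<tau> (insert u \<tau>) * cobd \<phi> (insert u \<tau>) = \<phi> \<tau> - (\<Sum>v\<in>\<tau>. h u v)"
      by (simp add: sum_negf)
  qed simp
  moreover have "cobd (bd \<phi>) \<tau> = (\<Sum>v\<in>\<tau>. \<phi> \<tau> + (\<Sum>u\<in>V - \<tau>. h u v))"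
    unfolding cobd_def
  proof (rule sum.cong)
    fix v assume v: "v \<in> \<tau>"
    have "V - (\<tau> - {v}) = insert v (V - \<tau>)" using v \<tau> by auto
    then have "bd \<phi> (\<tau> - {v}) = s (\<tau> - {v}) \<tau> * \<phi> \<tau> +
        (\<Sum>u\<in>V - \<tau>. s (\<tau> - {v}) (insert u (\<tau> - {v})) * \<phi> (insert u (\<tau> - {v})))"
      unfolding bd_def using finite_V v by (simp add: insert_absorb)
    then show "s (\<tau> - {v}) \<tau> * bd \<phi> (\<tau> - {v}) = \<phi> \<tau> + (\<Sum>u\<in>V - \<tau>. h u v)"
      using sign_square[OF \<tau> v]
      by (simp add: distrib_left sum_distrib_left mult.assoc[symmetric] h_def)
  qed simp
  moreover have "(\<Sum>u\<in>V - \<tau>. \<Sum>v\<in>\<tau>. h u v) = (\<Sum>v\<in>\<tau>. \<Sum>u\<in>V - \<tau>. h u v)" by (rule sum.swap)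
  moreover have "real (card (V - \<tau>)) + real (card \<tau>) = real (card V)"
    using \<tau> finite_V by (metis card_Diff_subset card_mono finite_subset_V le_add_diff_inverse2 of_nat_add)
  ultimately show ?thesis
    by (simp add: sum_subtractf sum.distrib) (metis distrib_right)
qed

text \<open>By adjointness the full squared norms of \<open>cobd \<phi>\<close> and
  \<open>bd \<phi>\<close> add up to the quadratic form of the complete Laplacian; the first of them
  splits into its parts over \<open>S\<close> and over the non-simplices.\<close>

lemma defect_eq:
  assumes "S \<subseteq> Pow V"
  shows "defect S \<phi> = real (card V) * inner_on (Pow V) \<phi> \<phi>
    - inner_on S (cobd \<phi>) (cobd \<phi>) - inner_on (Pow V) (bd \<phi>) (bd \<phi>)"
proof -
  have "inner_on (Pow V) (cobd \<phi>) (cobd \<phi>) = inner_on S (cobd \<phi>) (cobd \<phi>) + defect S \<phi>"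
    unfolding inner_on_def defect_def
    using sum.subset_diff[of S "Pow V" "\<lambda>\<sigma>. cobd \<phi> \<sigma> * cobd \<phi> \<sigma>"] assms finite_V
    by (simp add: power2_eq_square)
  moreover have "inner_on (Pow V) (cobd \<phi>) (cobd \<phi>) + inner_on (Pow V) (bd \<phi>) (bd \<phi>)
      = inner_on (Pow V) (\<lambda>\<tau>. bd (cobd \<phi>) \<tau> + cobd (bd \<phi>) \<tau>) \<phi>"
    by (simp add: inner_on_add_left bd_cobd_adjoint[of "cobd \<phi>"]
        inner_on_commute[of _ "cobd (bd \<phi>)"] flip: bd_cobd_adjoint[of \<phi> "bd \<phi>"])
  moreover have "\<dots> = real (card V) * inner_on (Pow V) \<phi> \<phi>"
    unfolding inner_on_def
    by (simp add: bd_cobd_plus_cobd_bd sum_distrib_left mult.assoc)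
  ultimately show ?thesis by simp
qed

text \<open>Up to sign, \<open>link u\<close> commutes with \<open>cobd\<close> by
  \<open>sign_exchange\<close>. The only term without a partner is a multiple of
  \<open>\<phi> \<tau>\<close>, which is assumed to be 0; for \<open>u \<in> \<tau>\<close> it is
  the only term at all.\<close>

lemma cobd_link:
  assumes \<tau>: "\<tau> \<subseteq> V" and u: "u \<in> V" and \<phi>: "\<phi> \<tau> = 0"
  shows "(cobd (link u \<phi>) \<tau>)\<^sup>2 = (if u \<in> \<tau> then 0 else (cobd \<phi> (insert u \<tau>))\<^sup>2)"
proof (cases "u \<in> \<tau>")
  case True
  have "s (\<tau> - {v}) \<tau> * link u \<phi> (\<tau> - {v}) = 0" if "v \<in> \<tau>" for v
    using True that \<phi> by (cases "u = v") (auto simp: link_def insert_absorb)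
  then show ?thesis using True by (simp add: cobd_def sum.neutral)
next
  case False
  have fin: "finite \<tau>" by (rule finite_subset_V[OF \<tau>])
  have "cobd \<phi> (insert u \<tau>) =
      (\<Sum>v\<in>\<tau>. s (insert u (\<tau> - {v})) (insert u \<tau>) * \<phi> (insert u (\<tau> - {v})))"
    unfolding cobd_def using False fin \<phi> by (simp add: insert_Diff_if) (intro sum.cong; auto)
  then have "s \<tau> (insert u \<tau>) * cobd \<phi> (insert u \<tau>) =
      (\<Sum>v\<in>\<tau>. s \<tau> (insert u \<tau>) * s (insert u (\<tau> - {v})) (insert u \<tau>) * \<phi> (insert u (\<tau> - {v})))"
    by (simp add: sum_distrib_left mult.assoc)
  also have "\<dots> = - cobd (link u \<phi>) \<tau>"
    unfolding cobd_def sum_negf[symmetric]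
    using False u \<tau> by (intro sum.cong) (auto simp: sign_exchange link_def)
  finally have "(cobd (link u \<phi>) \<tau>)\<^sup>2 = (s \<tau> (insert u \<tau>) * cobd \<phi> (insert u \<tau>))\<^sup>2" by simp
  also have "\<dots> = (cobd \<phi> (insert u \<tau>))\<^sup>2"
    using sign_square_insert[OF \<tau>, of u] u False by (simp add: power_mult_distrib power2_eq_square)
  finally show ?thesis using False by simp
qed

text \<open>Each face is seen once from each of its vertices.\<close>

lemma sum_inner_link:
  "(\<Sum>u\<in>V. inner_on (Pow V) (link u \<phi>) (link u \<phi>)) = (\<Sum>\<sigma>\<in>Pow V. real (card \<sigma>) * (\<phi> \<sigma>)\<^sup>2)"
proof -
  have "(\<Sum>u\<in>V. inner_on (Pow V) (link u \<phi>) (link u \<phi>))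
      = (\<Sum>\<tau>\<in>Pow V. \<Sum>u\<in>V. link u \<phi> \<tau> * link u \<phi> \<tau>)"
    unfolding inner_on_def by (rule sum.swap)
  also have "\<dots> = (\<Sum>\<tau>\<in>Pow V. \<Sum>u\<in>V - \<tau>. (\<phi> (insert u \<tau>))\<^sup>2)"
  proof (rule sum.cong)
    fix \<tau> assume "\<tau> \<in> Pow V"
    then have \<tau>: "\<tau> \<subseteq> V" by simp
    have "(\<Sum>u\<in>V. link u \<phi> \<tau> * link u \<phi> \<tau>) = (\<Sum>u\<in>V - \<tau>. link u \<phi> \<tau> * link u \<phi> \<tau>)"
      using finite_V by (intro sum.mono_neutral_right) (auto simp: link_def)
    also have "\<dots> = (\<Sum>u\<in>V - \<tau>. (\<phi> (insert u \<tau>))\<^sup>2)"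
    proof (rule sum.cong)
      fix u assume u: "u \<in> V - \<tau>"
      have "link u \<phi> \<tau> * link u \<phi> \<tau> = (s \<tau> (insert u \<tau>) * s \<tau> (insert u \<tau>)) * (\<phi> (insert u \<tau>))\<^sup>2"
        using u \<tau> by (simp add: link_def power2_eq_square)
      then show "link u \<phi> \<tau> * link u \<phi> \<tau> = (\<phi> (insert u \<tau>))\<^sup>2"
        unfolding sign_square_insert[OF \<tau> u] by simp
    qed simp
    finally show "(\<Sum>u\<in>V. link u \<phi> \<tau> * link u \<phi> \<tau>) = (\<Sum>u\<in>V - \<tau>. (\<phi> (insert u \<tau>))\<^sup>2)" .
  qed simp
  also have "\<dots> = (\<Sum>\<sigma>\<in>Pow V. real (card \<sigma>) * (\<phi> \<sigma>)\<^sup>2)"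
    unfolding sum_flags_swap by (intro sum.cong) (auto simp: insert_absorb)
  finally show ?thesis .
qed

text \<open>By \<open>cobd_link\<close>, which applies because \<open>\<phi>\<close> vanishes on the
  non-simplices, a non-simplex \<open>\<tau>\<close> hands the value at
  \<open>insert u \<tau>\<close> to the vertex \<open>u\<close>. So \<open>\<sigma>\<close> is
  counted once for each facet outside \<open>S\<close>.\<close>

lemma sum_defect_link:
  assumes S: "simplicial_complex V S" and \<phi>: "\<And>\<tau>. \<tau> \<notin> S \<Longrightarrow> \<phi> \<tau> = 0"
  shows "(\<Sum>u\<in>V. defect S (link u \<phi>)) =
    (\<Sum>\<sigma>\<in>Pow V - S. real (card {v\<in>\<sigma>. \<sigma> - {v} \<notin> S}) * (cobd \<phi> \<sigma>)\<^sup>2)"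
proof -
  have "(\<Sum>u\<in>V. defect S (link u \<phi>)) = (\<Sum>\<tau>\<in>Pow V - S. \<Sum>u\<in>V. (cobd (link u \<phi>) \<tau>)\<^sup>2)"
    unfolding defect_def by (rule sum.swap)
  also have "\<dots> = (\<Sum>\<tau>\<in>Pow V - S. \<Sum>u\<in>V - \<tau>. (cobd \<phi> (insert u \<tau>))\<^sup>2)"
  proof (rule sum.cong)
    fix \<tau> assume \<tau>: "\<tau> \<in> Pow V - S"
    have "(\<Sum>u\<in>V. (cobd (link u \<phi>) \<tau>)\<^sup>2) = (\<Sum>u\<in>V. if u \<in> \<tau> then 0 else (cobd \<phi> (insert u \<tau>))\<^sup>2)"
      using \<tau> \<phi> by (intro sum.cong cobd_link) auto
    also have "\<dots> = (\<Sum>u\<in>V - \<tau>. (cobd \<phi> (insert u \<tau>))\<^sup>2)"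
      using finite_V by (intro sum.mono_neutral_cong_right) auto
    finally show "(\<Sum>u\<in>V. (cobd (link u \<phi>) \<tau>)\<^sup>2) = (\<Sum>u\<in>V - \<tau>. (cobd \<phi> (insert u \<tau>))\<^sup>2)" .
  qed simp
  also have "\<dots> = (\<Sum>\<tau>\<in>Pow V. \<Sum>u\<in>V - \<tau>. if \<tau> \<in> S then 0 else (cobd \<phi> (insert u \<tau>))\<^sup>2)"
    using finite_V by (intro sum.mono_neutral_cong_left) auto
  also have "\<dots> = (\<Sum>\<sigma>\<in>Pow V. \<Sum>v\<in>\<sigma>. if \<sigma> - {v} \<in> S then 0 else (cobd \<phi> (insert v (\<sigma> - {v})))\<^sup>2)"
    by (rule sum_flags_swap)
  also have "\<dots> = (\<Sum>\<sigma>\<in>Pow V. real (card {v\<in>\<sigma>. \<sigma> - {v} \<notin> S}) * (cobd \<phi> \<sigma>)\<^sup>2)"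
  proof (rule sum.cong)
    fix \<sigma> assume "\<sigma> \<in> Pow V"
    then have "finite \<sigma>" using finite_subset_V by blast
    have "(\<Sum>v\<in>\<sigma>. if \<sigma> - {v} \<in> S then 0 else (cobd \<phi> (insert v (\<sigma> - {v})))\<^sup>2)
        = (\<Sum>v\<in>{v\<in>\<sigma>. \<sigma> - {v} \<notin> S}. (cobd \<phi> \<sigma>)\<^sup>2)"
      using \<open>finite \<sigma>\<close> by (intro sum.mono_neutral_cong_right) (auto simp: insert_absorb)
    then show "(\<Sum>v\<in>\<sigma>. if \<sigma> - {v} \<in> S then 0 else (cobd \<phi> (insert v (\<sigma> - {v})))\<^sup>2)
        = real (card {v\<in>\<sigma>. \<sigma> - {v} \<notin> S}) * (cobd \<phi> \<sigma>)\<^sup>2" by simp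
  qed simp
  \<comment> \<open>All facets of a simplex of \<open>S\<close> are in \<open>S\<close>, so its
    coefficient is 0.\<close>
  also have "\<dots> = (\<Sum>\<sigma>\<in>Pow V - S. real (card {v\<in>\<sigma>. \<sigma> - {v} \<notin> S}) * (cobd \<phi> \<sigma>)\<^sup>2)"
  proof (rule sum.mono_neutral_right)
    show "\<forall>\<sigma>\<in>Pow V - (Pow V - S). real (card {v\<in>\<sigma>. \<sigma> - {v} \<notin> S}) * (cobd \<phi> \<sigma>)\<^sup>2 = 0"
    proof
      fix \<sigma> assume "\<sigma> \<in> Pow V - (Pow V - S)"
      then have "{v\<in>\<sigma>. \<sigma> - {v} \<notin> S} = {}" using S by (auto simp: simplicial_complex_def)
      then show "real (card {v\<in>\<sigma>. \<sigma> - {v} \<notin> S}) * (cobd \<phi> \<sigma>)\<^sup>2 = 0"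
        by (simp only: card.empty of_nat_0 mult_zero_left)
    qed
  qed (use finite_V in auto)
  finally show ?thesis .
qed

end

section \<open>Facet counts and the numbers \<open>beta\<close>\<close>

text \<open>Translates the count in the definition of \<open>beta\<close> into the count by removed
  vertices that \<open>sum_defect_link\<close> produces.\<close>

lemma card_facets_in_complex:
  assumes "int (card \<sigma>) = j + 2" "finite \<sigma>"
  shows "card {\<tau> \<in> simplices S j. \<tau> \<subseteq> \<sigma>} = card {v\<in>\<sigma>. \<sigma> - {v} \<in> S}"
proof -
  have "{\<tau> \<in> simplices S j. \<tau> \<subseteq> \<sigma>} = (\<lambda>v. \<sigma> - {v}) ` {v\<in>\<sigma>. \<sigma> - {v} \<in> S}"
  proof (intro equalityI subsetI)
    fix \<tau> assume "\<tau> \<in> {\<tau> \<in> simplices S j. \<tau> \<subseteq> \<sigma>}"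
    then have \<tau>: "\<tau> \<in> S" "int (card \<tau>) = j + 1" "\<tau> \<subseteq> \<sigma>" by (auto simp: simplices_def)
    have "card (\<sigma> - \<tau>) = 1"
      using assms \<tau> card_Diff_subset[of \<tau> \<sigma>] finite_subset[of \<tau> \<sigma>] by auto
    then obtain v where "\<sigma> - \<tau> = {v}" by (auto simp: card_1_singleton_iff)
    then have "v \<in> \<sigma>" "\<tau> = \<sigma> - {v}" using \<tau>(3) by auto
    then show "\<tau> \<in> (\<lambda>v. \<sigma> - {v}) ` {v\<in>\<sigma>. \<sigma> - {v} \<in> S}" using \<tau>(1) by auto
  next
    fix \<tau> assume "\<tau> \<in> (\<lambda>v. \<sigma> - {v}) ` {v\<in>\<sigma>. \<sigma> - {v} \<in> S}"
    then obtain v where "v \<in> \<sigma>" "\<sigma> - {v} \<in> S" "\<tau> = \<sigma> - {v}" by auto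
    moreover have "card \<sigma> > 0" using \<open>v \<in> \<sigma>\<close> assms(2) by (auto simp: card_gt_0_iff)
    ultimately show "\<tau> \<in> {\<tau> \<in> simplices S j. \<tau> \<subseteq> \<sigma>}"
      using assms by (auto simp: simplices_def)
  qed
  moreover have "inj_on (\<lambda>v. \<sigma> - {v}) {v\<in>\<sigma>. \<sigma> - {v} \<in> S}" by (auto simp: inj_on_def)
  ultimately show ?thesis by (simp add: card_image)
qed

lemma missing_simplices_card:
  assumes "finite V" "\<sigma> \<in> missing_simplices V S j"
  shows "finite \<sigma>" "int (card \<sigma>) = j + 2"
  using assms by (auto simp: missing_simplices_def simplices_def intro: finite_subset)

lemma finite_missing_simplices: "finite V \<Longrightarrow> finite (missing_simplices V S j)"
  by (rule finite_subset[of _ "Pow V"]) (auto simp: missing_simplices_def simplices_def)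

lemma card_facets_le_beta:
  assumes "finite V" "\<sigma> \<in> missing_simplices V S j"
  shows "int (card {v\<in>\<sigma>. \<sigma> - {v} \<in> S}) \<le> beta V S j + 1"
proof -
  have "card {\<tau> \<in> simplices S j. \<tau> \<subseteq> \<sigma>}
      \<le> (MAX \<sigma>\<in>missing_simplices V S j. card {\<tau> \<in> simplices S j. \<tau> \<subseteq> \<sigma>})"
    using assms finite_missing_simplices by (intro Max_ge) auto
  then show ?thesis
    using assms missing_simplices_card[OF assms] by (auto simp: beta_def card_facets_in_complex)
qed

text \<open>A set of \<open>j + 2\<close> vertices has only \<open>j + 2\<close> facets. The use is
  that the factors \<open>j + 1 - beta V S j\<close> are nonnegative and inequalities may be
  multiplied by them.\<close>

lemma beta_le:
  assumes "finite V" "j \<ge> -1"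
  shows "beta V S j \<le> j + 1"
proof (cases "missing_simplices V S j = {}")
  case False
  have "card {\<tau> \<in> simplices S j. \<tau> \<subseteq> \<sigma>} \<le> nat (j + 2)"
    if "\<sigma> \<in> missing_simplices V S j" for \<sigma>
  proof -
    note \<sigma> = missing_simplices_card[OF assms(1) that]
    have "card {v\<in>\<sigma>. \<sigma> - {v} \<in> S} \<le> card \<sigma>" using \<sigma> by (intro card_mono) auto
    then show ?thesis using \<sigma> by (simp add: card_facets_in_complex)
  qed
  then have "(MAX \<sigma>\<in>missing_simplices V S j. card {\<tau> \<in> simplices S j. \<tau> \<subseteq> \<sigma>}) \<le> nat (j + 2)"
    using False finite_missing_simplices[OF assms(1)] by (subst Max_le_iff) auto
  then show ?thesis using assms(2) False unfolding beta_def by (simp only: if_False)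
qed (use assms in \<open>simp add: beta_def\<close>)

section \<open>Raising a defect bound by one dimension\<close>

context incidence_signs
begin

lemma link_in_l2:
  assumes S: "simplicial_complex V S" and \<phi>: "\<phi> \<in> l2 S j" and u: "u \<in> V"
  shows "link u \<phi> \<in> l2 S (j - 1)"
  unfolding l2_def
proof (intro CollectI allI impI)
  fix \<tau> assume \<tau>: "\<tau> \<notin> simplices S (j - 1)"
  show "link u \<phi> \<tau> = 0"
  proof (cases "u \<notin> \<tau> \<and> \<tau> \<subseteq> V")
    case True
    then have "finite \<tau>" using finite_subset_V by blast
    have "insert u \<tau> \<notin> simplices S j"
    proof
      assume "insert u \<tau> \<in> simplices S j"
      then have "insert u \<tau> \<in> S" "int (card (insert u \<tau>)) = j + 1" by (auto simp: simplices_def)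
      moreover from this have "\<tau> \<in> S" using S unfolding simplicial_complex_def by blast
      ultimately show False using \<tau> True \<open>finite \<tau>\<close> by (simp add: simplices_def)
    qed
    then show ?thesis using \<phi> by (simp add: link_def l2_def)
  qed (auto simp: link_def)
qed

text \<open>A non-simplex with nonzero coboundary has a facet in the support of
  \<open>\<phi>\<close>, hence is one of the missing simplices that \<open>beta\<close> ranges over.
  Of its \<open>j + 2\<close> facets at most \<open>beta V S j + 1\<close> are in
  \<open>S\<close>.\<close>

lemma defect_le_sum_defect_link:
  assumes S: "simplicial_complex V S" and \<phi>: "\<phi> \<in> l2 S j"
  shows "(real_of_int j + 1 - real_of_int (beta V S j)) * defect S \<phi> \<le> (\<Sum>u\<in>V. defect S (link u \<phi>))"
proof -
  have \<phi>0: "\<phi> \<tau> = 0" if "\<tau> \<notin> simplices S j" for \<tau> using \<phi> that by (simp add: l2_def)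
  have "(real_of_int j + 1 - real_of_int (beta V S j)) * defect S \<phi> =
      (\<Sum>\<sigma>\<in>Pow V - S. (real_of_int j + 1 - real_of_int (beta V S j)) * (cobd \<phi> \<sigma>)\<^sup>2)"
    by (simp add: defect_def sum_distrib_left)
  also have "\<dots> \<le> (\<Sum>\<sigma>\<in>Pow V - S. real (card {v\<in>\<sigma>. \<sigma> - {v} \<notin> S}) * (cobd \<phi> \<sigma>)\<^sup>2)"
  proof (rule sum_mono)
    fix \<sigma> assume \<sigma>: "\<sigma> \<in> Pow V - S"
    then have fin: "finite \<sigma>" using finite_subset_V by blast
    show "(real_of_int j + 1 - real_of_int (beta V S j)) * (cobd \<phi> \<sigma>)\<^sup>2
        \<le> real (card {v\<in>\<sigma>. \<sigma> - {v} \<notin> S}) * (cobd \<phi> \<sigma>)\<^sup>2"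
    proof (cases "cobd \<phi> \<sigma> = 0")
      case False
      then obtain v where v: "v \<in> \<sigma>" "\<phi> (\<sigma> - {v}) \<noteq> 0"
        unfolding cobd_def by (metis (no_types, lifting) mult_zero_right sum.neutral)
      then have face: "\<sigma> - {v} \<in> simplices S j" using \<phi>0 by blast
      have "card \<sigma> > 0" using v(1) fin by (auto simp: card_gt_0_iff)
      with face v(1) fin have card: "int (card \<sigma>) = j + 2"
        by (simp add: simplices_def)
      have "\<sigma> \<in> missing_simplices V S j"
        using \<sigma> card face by (auto simp: missing_simplices_def simplices_def)
      then have "int (card {v\<in>\<sigma>. \<sigma> - {v} \<in> S}) \<le> beta V S j + 1"
        by (rule card_facets_le_beta[OF finite_V])
      moreover have "card \<sigma> = card {v\<in>\<sigma>. \<sigma> - {v} \<in> S} + card {v\<in>\<sigma>. \<sigma> - {v} \<notin> S}"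
        using fin by (subst card_Un_disjoint[symmetric]) (auto intro: arg_cong[where f = card])
      ultimately have "j + 1 - beta V S j \<le> int (card {v\<in>\<sigma>. \<sigma> - {v} \<notin> S})"
        using card by simp
      then have "real_of_int (j + 1 - beta V S j) \<le> real_of_int (int (card {v\<in>\<sigma>. \<sigma> - {v} \<notin> S}))"
        by (simp only: of_int_le_iff)
      then show ?thesis by (intro mult_right_mono) auto
    qed simp
  qed
  also have "\<dots> = (\<Sum>u\<in>V. defect S (link u \<phi>))"
    using \<phi>0 by (intro sum_defect_link[OF S, symmetric]) (auto simp: simplices_def)
  finally show ?thesis .
qed

lemma sum_inner_link_l2:
  assumes "\<phi> \<in> l2 S j"
  shows "(\<Sum>u\<in>V. inner_on (Pow V) (link u \<phi>) (link u \<phi>)) = (real_of_int j + 1) * inner_on (Pow V) \<phi> \<phi>"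
  unfolding sum_inner_link unfolding inner_on_def sum_distrib_left
proof (rule sum.cong)
  fix \<sigma>
  show "real (card \<sigma>) * (\<phi> \<sigma>)\<^sup>2 = (real_of_int j + 1) * (\<phi> \<sigma> * \<phi> \<sigma>)"
  proof (cases "\<sigma> \<in> simplices S j")
    case True
    then have "int (card \<sigma>) = j + 1" by (simp add: simplices_def)
    then have "real (card \<sigma>) = real_of_int j + 1" by linarith
    then show ?thesis by (simp add: power2_eq_square)
  qed (use assms in \<open>simp add: l2_def\<close>)
qed simp

text \<open>Induction on the dimension, with the hypothesis applied to every
  \<open>link u \<phi>\<close>. Adding up over \<open>u\<close> multiplies the right side by
  \<open>Suc k + 1\<close>, the number of vertices of a simplex of dimension \<open>Suc k\<close>,
  which advances the factorial.\<close>

lemma defect_bound_raise: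
  fixes l k :: nat
  assumes S: "simplicial_complex V S" and "l \<le> k"
    and base: "\<And>\<phi>. \<phi> \<in> l2 S (int l) \<Longrightarrow> defect S \<phi> \<le> c * inner_on (Pow V) \<phi> \<phi>"
    and "\<phi> \<in> l2 S (int k)"
  shows "(\<Prod>j = l + 1..k. real j + 1 - real_of_int (beta V S (int j))) * defect S \<phi>
    \<le> fact (k + 1) / fact (l + 1) * c * inner_on (Pow V) \<phi> \<phi>"
  using assms(2,4)
proof (induction k arbitrary: \<phi> rule: dec_induct)
  case base
  then show ?case using assms(3) by simp
next
  case (step k)
  define P where "P = (\<Prod>j = l + 1..k. real j + 1 - real_of_int (beta V S (int j)))"
  have P: "P \<ge> 0"
    unfolding P_def
  proof (rule prod_nonneg)
    fix j
    have "real_of_int (beta V S (int j)) \<le> real_of_int (int j + 1)"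
      using beta_le[OF finite_V, of "int j" S] by (simp only: of_int_le_iff)
    then show "0 \<le> real j + 1 - real_of_int (beta V S (int j))" by simp
  qed
  have "(\<Prod>j = l + 1..Suc k. real j + 1 - real_of_int (beta V S (int j))) * defect S \<phi>
      = P * ((real (Suc k) + 1 - real_of_int (beta V S (int (Suc k)))) * defect S \<phi>)"
    using step.hyps by (simp add: P_def)
  also have "\<dots> \<le> P * (\<Sum>u\<in>V. defect S (link u \<phi>))"
    using defect_le_sum_defect_link[OF S step.prems] P by (intro mult_left_mono) simp_all
  also have "\<dots> \<le> (\<Sum>u\<in>V. fact (k + 1) / fact (l + 1) * c * inner_on (Pow V) (link u \<phi>) (link u \<phi>))"
    unfolding sum_distrib_left P_def
    using link_in_l2[OF S step.prems] by (intro sum_mono step.IH) simp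
  also have "\<dots> = fact (k + 1) / fact (l + 1) * c * ((real (Suc k) + 1) * inner_on (Pow V) \<phi> \<phi>)"
    using sum_inner_link_l2[OF step.prems] unfolding sum_distrib_left[symmetric] by simp
  also have "\<dots> = fact (Suc k + 1) / fact (l + 1) * c * inner_on (Pow V) \<phi> \<phi>"
    by (simp add: field_simps)
  finally show ?case .
qed

end

section \<open>The Hodge Laplacian of a subcomplex\<close>

locale complete_coboundary =
  fixes V :: "'a set" and dhat :: "'a graded_operator"
  assumes finite_vertices: "finite V"
    and coboundary: "coboundary_operators (Pow V) dhat"
begin

text \<open>The dimension of \<open>\<tau>\<close>, one less than its cardinality, selects the
  operator, so a single function holds the matrix entries of all \<open>dhat k\<close>.\<close>

definition sign :: "'a set \<Rightarrow> 'a set \<Rightarrow> real" where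
  "sign \<tau> \<sigma> = dhat (int (card \<tau>) - 1) (indicator {\<tau>}) \<sigma>"

lemma dhat_linear:
  "k \<ge> -1 \<Longrightarrow> linear_between (l2 (Pow V) k) (l2 (Pow V) (k + 1)) (dhat k)"
  using coboundary by (auto simp: coboundary_operators_def)

lemma dhat_dhat: "k \<ge> -1 \<Longrightarrow> \<phi> \<in> l2 (Pow V) k \<Longrightarrow> dhat (k + 1) (dhat k \<phi>) = (\<lambda>_. 0)"
  using coboundary by (auto simp: coboundary_operators_def)

lemma finite_simplices_Pow: "finite (simplices (Pow V) k)"
  using finite_vertices by (auto simp: simplices_def)

lemma dhat_expand:
  assumes "k \<ge> -1" "\<phi> \<in> l2 (Pow V) k"
  shows "dhat k \<phi> \<sigma> = (\<Sum>\<tau>\<in>simplices (Pow V) k. \<phi> \<tau> * sign \<tau> \<sigma>)"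
proof -
  have "dhat k \<phi> \<sigma> = (\<Sum>\<tau>\<in>simplices (Pow V) k. \<phi> \<tau> * dhat k (indicator {\<tau>}) \<sigma>)"
    by (rule linear_between_expand[OF dhat_linear[OF assms(1), unfolded l2_eq_funs_on]
          finite_simplices_Pow assms(2)[unfolded l2_eq_funs_on]])
  then show ?thesis by (auto simp: sign_def simplices_def intro!: sum.cong)
qed

lemma sign_values:
  assumes "\<sigma> \<subseteq> V" "\<tau> \<subseteq> V" "card \<sigma> = card \<tau> + 1"
  shows "sign \<tau> \<sigma> \<in> {1, -1, 0}" "sign \<tau> \<sigma> \<noteq> 0 \<longleftrightarrow> facet \<tau> \<sigma>"
proof -
  define k where "k = int (card \<tau>) - 1"
  have *: "k \<ge> -1" "\<tau> \<in> simplices (Pow V) k" "\<sigma> \<in> simplices (Pow V) (k + 1)"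
    using assms by (auto simp: simplices_def k_def)
  then have "dhat k (indicator {\<tau>}) \<sigma> \<in> {1, -1, 0} \<and> (dhat k (indicator {\<tau>}) \<sigma> \<noteq> 0 \<longleftrightarrow> facet \<tau> \<sigma>)"
    using coboundary unfolding coboundary_operators_def by blast
  then show "sign \<tau> \<sigma> \<in> {1, -1, 0}" "sign \<tau> \<sigma> \<noteq> 0 \<longleftrightarrow> facet \<tau> \<sigma>"
    by (auto simp: sign_def k_def)
qed

lemma facet_iff:
  assumes "finite \<sigma>"
  shows "facet \<tau> \<sigma> \<longleftrightarrow> (\<exists>v\<in>\<sigma>. \<tau> = \<sigma> - {v})"
proof
  assume "facet \<tau> \<sigma>"
  then obtain v where "\<tau> \<subseteq> \<sigma>" "\<sigma> - \<tau> = {v}" by (auto simp: facet_def card_1_singleton_iff)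
  then have "v \<in> \<sigma>" "\<tau> = \<sigma> - {v}" by auto
  then show "\<exists>v\<in>\<sigma>. \<tau> = \<sigma> - {v}" by blast
next
  assume "\<exists>v\<in>\<sigma>. \<tau> = \<sigma> - {v}"
  then obtain v where "v \<in> \<sigma>" "\<tau> = \<sigma> - {v}" by blast
  moreover from this have "\<sigma> - \<tau> = {v}" by auto
  ultimately show "facet \<tau> \<sigma>" by (auto simp: facet_def)
qed

sublocale incidence_signs V sign
proof
  fix \<sigma> v assume \<sigma>: "\<sigma> \<subseteq> V" "v \<in> \<sigma>"
  then have fin: "finite \<sigma>" using finite_vertices finite_subset by blast
  then have "card \<sigma> = card (\<sigma> - {v}) + 1" using \<sigma>(2) card_Suc_Diff1[of \<sigma> v] by simp
  then show "sign (\<sigma> - {v}) \<sigma> * sign (\<sigma> - {v}) \<sigma> = 1"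
    using sign_values[of \<sigma> "\<sigma> - {v}"] \<sigma> facet_iff[OF fin] by force
next
  fix \<rho> u v assume \<rho>: "\<rho> \<subseteq> V" "u \<in> V - \<rho>" "v \<in> V - \<rho>" "u \<noteq> v"
  define \<sigma> where "\<sigma> = insert u (insert v \<rho>)"
  define k where "k = int (card \<rho>) - 1"
  have fin: "finite \<rho>" using \<rho>(1) finite_vertices finite_subset by blast
  have k: "k \<ge> -1" by (simp add: k_def)
  have \<rho>k: "\<rho> \<in> simplices (Pow V) k" using \<rho> by (simp add: simplices_def k_def)
  have \<sigma>: "\<sigma> \<subseteq> V" "card \<sigma> = card \<rho> + 2" using \<rho> fin by (auto simp: \<sigma>_def)
  have ind: "indicator {\<rho>} \<in> l2 (Pow V) k"
    unfolding l2_eq_funs_on by (rule indicator_in_funs_on[OF \<rho>k])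
  have dind: "dhat k (indicator {\<rho>}) \<in> l2 (Pow V) (k + 1)"
    by (rule linear_between_in[OF dhat_linear[OF k] ind])
  \<comment> \<open>The matrix entry of the squared coboundary at \<open>\<rho>\<close> and
    \<open>\<sigma>\<close>: a nonzero summand needs a face strictly between the two, and there are
    only two of these.\<close>
  have "0 = dhat (k + 1) (dhat k (indicator {\<rho>})) \<sigma>" using dhat_dhat[OF k ind] by simp
  also have "\<dots> = (\<Sum>\<tau>\<in>simplices (Pow V) (k + 1). sign \<rho> \<tau> * sign \<tau> \<sigma>)"
    using k by (subst dhat_expand[OF _ dind]) (auto simp: sign_def k_def)
  also have "\<dots> = (\<Sum>\<tau>\<in>{insert u \<rho>, insert v \<rho>}. sign \<rho> \<tau> * sign \<tau> \<sigma>)"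
  proof (rule sum.mono_neutral_right[OF finite_simplices_Pow])
    show "{insert u \<rho>, insert v \<rho>} \<subseteq> simplices (Pow V) (k + 1)"
      using \<rho> fin by (auto simp: simplices_def k_def)
    show "\<forall>\<tau>\<in>simplices (Pow V) (k + 1) - {insert u \<rho>, insert v \<rho>}. sign \<rho> \<tau> * sign \<tau> \<sigma> = 0"
    proof (intro ballI, rule ccontr)
      fix \<tau> assume \<tau>: "\<tau> \<in> simplices (Pow V) (k + 1) - {insert u \<rho>, insert v \<rho>}"
        and ne: "sign \<rho> \<tau> * sign \<tau> \<sigma> \<noteq> 0"
      have \<tau>V: "\<tau> \<subseteq> V" "card \<tau> = card \<rho> + 1" using \<tau> by (auto simp: simplices_def k_def)
      have "facet \<rho> \<tau>" using sign_values(2)[of \<tau> \<rho>] \<tau>V \<rho>(1) ne by auto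
      moreover have "facet \<tau> \<sigma>" using sign_values(2)[of \<sigma> \<tau>] \<tau>V \<sigma> ne by auto
      moreover have "finite \<tau>" "finite \<sigma>" using \<tau>V(1) \<sigma>(1) finite_vertices finite_subset by blast+
      ultimately obtain x y where "x \<in> \<tau>" "\<rho> = \<tau> - {x}" "y \<in> \<sigma>" "\<tau> = \<sigma> - {y}"
        by (auto simp: facet_iff)
      then have "\<tau> = insert x \<rho>" "x \<in> \<sigma>" "x \<notin> \<rho>" by auto
      then show False using \<tau> by (auto simp: \<sigma>_def)
    qed
  qed
  also have "\<dots> = sign \<rho> (insert u \<rho>) * sign (insert u \<rho>) \<sigma> + sign \<rho> (insert v \<rho>) * sign (insert v \<rho>) \<sigma>"
    using \<rho> by (subst sum.insert) auto
  finally show "sign \<rho> (insert u \<rho>) * sign (insert u \<rho>) (insert u (insert v \<rho>)) +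
      sign \<rho> (insert v \<rho>) * sign (insert v \<rho>) (insert u (insert v \<rho>)) = 0"
    by (simp add: \<sigma>_def)
qed (rule finite_vertices)

text \<open>The matrix expansion, reduced to the facets of \<open>\<sigma>\<close>. In other
  dimensions than \<open>k + 1\<close> both sides vanish, because no facet of
  \<open>\<sigma>\<close> carries a value of \<open>\<phi>\<close>.\<close>

lemma dhat_eq_cobd:
  assumes k: "k \<ge> -1" and \<phi>: "\<phi> \<in> l2 (Pow V) k" and \<sigma>: "\<sigma> \<subseteq> V"
  shows "dhat k \<phi> \<sigma> = cobd \<phi> \<sigma>"
proof -
  have fin: "finite \<sigma>" by (rule finite_subset_V[OF \<sigma>])
  show ?thesis
  proof (cases "\<sigma> \<in> simplices (Pow V) (k + 1)")
    case True
    then have card: "int (card \<sigma>) = k + 2" by (simp add: simplices_def)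
    have "dhat k \<phi> \<sigma> = (\<Sum>\<tau>\<in>simplices (Pow V) k. \<phi> \<tau> * sign \<tau> \<sigma>)"
      by (rule dhat_expand[OF k \<phi>])
    also have "\<dots> = (\<Sum>\<tau>\<in>(\<lambda>v. \<sigma> - {v}) ` \<sigma>. \<phi> \<tau> * sign \<tau> \<sigma>)"
    proof (rule sum.mono_neutral_right[OF finite_simplices_Pow])
      show "(\<lambda>v. \<sigma> - {v}) ` \<sigma> \<subseteq> simplices (Pow V) k"
      proof
        fix \<tau> assume "\<tau> \<in> (\<lambda>v. \<sigma> - {v}) ` \<sigma>"
        then obtain v where v: "v \<in> \<sigma>" "\<tau> = \<sigma> - {v}" by blast
        then have "card \<sigma> = card \<tau> + 1" using fin card_Suc_Diff1[of \<sigma> v] by simp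
        then show "\<tau> \<in> simplices (Pow V) k" using v \<sigma> card by (auto simp: simplices_def)
      qed
      show "\<forall>\<tau>\<in>simplices (Pow V) k - (\<lambda>v. \<sigma> - {v}) ` \<sigma>. \<phi> \<tau> * sign \<tau> \<sigma> = 0"
      proof
        fix \<tau> assume \<tau>: "\<tau> \<in> simplices (Pow V) k - (\<lambda>v. \<sigma> - {v}) ` \<sigma>"
        then have "\<not> facet \<tau> \<sigma>" by (auto simp: facet_iff[OF fin])
        moreover have "\<tau> \<subseteq> V" "card \<sigma> = card \<tau> + 1" using \<tau> card by (auto simp: simplices_def)
        ultimately show "\<phi> \<tau> * sign \<tau> \<sigma> = 0" using sign_values(2)[OF \<sigma>] by auto
      qed
    qed
    also have "\<dots> = cobd \<phi> \<sigma>"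
      unfolding cobd_def by (subst sum.reindex) (auto simp: inj_on_def mult.commute)
    finally show ?thesis .
  next
    case False
    have "\<phi> (\<sigma> - {v}) = 0" if v: "v \<in> \<sigma>" for v
    proof -
      have "card \<sigma> = card (\<sigma> - {v}) + 1" using v fin card_Suc_Diff1[of \<sigma> v] by simp
      then have "\<sigma> - {v} \<notin> simplices (Pow V) k" using False \<sigma> by (auto simp: simplices_def)
      then show ?thesis using \<phi> by (simp add: l2_def)
    qed
    then have "cobd \<phi> \<sigma> = 0" by (simp add: cobd_def)
    then show ?thesis
      using linear_between_in[OF dhat_linear[OF k] \<phi>] False by (simp add: l2_def)
  qed
qed

end

section \<open>Coboundary and boundary of the subcomplex\<close>

locale induced_complex = complete_coboundary +
  fixes S :: "'a set set"
  assumes complex: "simplicial_complex V S"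
begin

abbreviation d :: "'a graded_operator" where
  "d \<equiv> induced_coboundary S dhat"

lemma S_subset: "S \<subseteq> Pow V"
  using complex by (simp add: simplicial_complex_def)

lemma faces: "\<sigma> \<in> S \<Longrightarrow> \<tau> \<subseteq> \<sigma> \<Longrightarrow> \<tau> \<in> S"
  using complex by (auto simp: simplicial_complex_def)

lemma finite_S: "finite S"
  using S_subset finite_V finite_subset by blast

lemma finite_simplices: "finite (simplices S k)"
  using finite_S by (auto simp: simplices_def)

lemma l2_complete: "\<phi> \<in> l2 S k \<Longrightarrow> \<phi> \<in> l2 (Pow V) k"
  using S_subset by (auto simp: l2_def simplices_def)

lemma d_eq_cobd:
  assumes "k \<ge> -1" "\<phi> \<in> l2 S k"
  shows "d k \<phi> \<sigma> = (if \<sigma> \<in> S then cobd \<phi> \<sigma> else 0)"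
proof (cases "\<sigma> \<in> S")
  case True
  then have "dhat k \<phi> \<sigma> = cobd \<phi> \<sigma>"
    using S_subset by (intro dhat_eq_cobd[OF assms(1) l2_complete[OF assms(2)]]) auto
  moreover have "dhat k \<phi> \<sigma> = 0" if "\<sigma> \<notin> simplices S (k + 1)"
    using linear_between_in[OF dhat_linear[OF assms(1)] l2_complete[OF assms(2)]] that True
    by (auto simp: l2_def simplices_def)
  ultimately show ?thesis using True by (auto simp: induced_coboundary_def l2_restrict_def)
qed (simp add: induced_coboundary_def l2_restrict_def simplices_def)

lemma d_linear:
  assumes "k \<ge> -1"
  shows "linear_between (l2 S k) (l2 S (k + 1)) (d k)"
  unfolding linear_between_def
proof (intro conjI ballI allI)
  show "d k \<in> l2 S k \<rightarrow> l2 S (k + 1)"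
    by (auto simp: l2_def induced_coboundary_def l2_restrict_def)
next
  fix \<phi> \<psi> assume "\<phi> \<in> l2 S k" "\<psi> \<in> l2 S k"
  then have "dhat k (\<lambda>x. \<phi> x + \<psi> x) = (\<lambda>x. dhat k \<phi> x + dhat k \<psi> x)"
    by (intro linear_between_add[OF dhat_linear[OF assms]] l2_complete)
  then show "d k (\<lambda>x. \<phi> x + \<psi> x) = (\<lambda>x. d k \<phi> x + d k \<psi> x)"
    by (auto simp: induced_coboundary_def l2_restrict_def)
next
  fix c \<phi> assume "\<phi> \<in> l2 S k"
  then have "dhat k (\<lambda>x. c * \<phi> x) = (\<lambda>x. c * dhat k \<phi> x)"
    by (intro linear_between_scale[OF dhat_linear[OF assms]] l2_complete)
  then show "d k (\<lambda>x. c * \<phi> x) = (\<lambda>x. c * d k \<phi> x)"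
    by (auto simp: induced_coboundary_def l2_restrict_def)
qed

text \<open>At a simplex of \<open>S\<close> the outer coboundary reads only values at its facets.
  These lie in \<open>S\<close>, where the restriction has changed nothing.\<close>

lemma d_d:
  assumes k: "k \<ge> -1" and \<phi>: "\<phi> \<in> l2 S k"
  shows "d (k + 1) (d k \<phi>) = (\<lambda>_. 0)"
proof
  fix \<sigma>
  note \<phi>' = l2_complete[OF \<phi>]
  have d\<phi>: "d k \<phi> \<in> l2 S (k + 1)" by (rule linear_between_in[OF d_linear[OF k] \<phi>])
  have k1: "k + 1 \<ge> -1" using k by simp
  show "d (k + 1) (d k \<phi>) \<sigma> = 0"
  proof (cases "\<sigma> \<in> S")
    case True
    then have \<sigma>: "\<sigma> \<subseteq> V" using S_subset by auto
    have "d (k + 1) (d k \<phi>) \<sigma> = cobd (d k \<phi>) \<sigma>" using True d_eq_cobd[OF k1 d\<phi>] by simp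
    also have "\<dots> = cobd (dhat k \<phi>) \<sigma>"
      unfolding cobd_def
    proof (rule sum.cong)
      fix v assume "v \<in> \<sigma>"
      have "\<sigma> - {v} \<in> S" by (rule faces[OF True]) auto
      moreover from this have "\<sigma> - {v} \<subseteq> V" using S_subset by auto
      ultimately have "d k \<phi> (\<sigma> - {v}) = dhat k \<phi> (\<sigma> - {v})"
        by (simp add: d_eq_cobd[OF k \<phi>] dhat_eq_cobd[OF k \<phi>'])
      then show "sign (\<sigma> - {v}) \<sigma> * d k \<phi> (\<sigma> - {v}) = sign (\<sigma> - {v}) \<sigma> * dhat k \<phi> (\<sigma> - {v})"
        by simp
    qed simp
    also have "\<dots> = dhat (k + 1) (dhat k \<phi>) \<sigma>"
      by (rule dhat_eq_cobd[OF k1 linear_between_in[OF dhat_linear[OF k] \<phi>'] \<sigma>, symmetric])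
    also have "\<dots> = 0" using dhat_dhat[OF k \<phi>'] by simp
    finally show ?thesis .
  qed (simp add: d_eq_cobd[OF k1 d\<phi>])
qed

lemma inner_on_simplices:
  assumes "\<phi> \<in> l2 S k"
  shows "inner_on (simplices S k) \<phi> \<psi> = inner_on (Pow V) \<phi> \<psi>"
  unfolding inner_on_def using assms S_subset finite_V
  by (intro sum.mono_neutral_left) (auto simp: l2_def simplices_def)

lemma inner_on_d:
  assumes "k \<ge> -1" "\<phi> \<in> l2 S k"
  shows "inner_on (simplices S (k + 1)) (d k \<phi>) (d k \<phi>) = inner_on S (cobd \<phi>) (cobd \<phi>)"
proof -
  have "inner_on (simplices S (k + 1)) (d k \<phi>) (d k \<phi>) = inner_on (Pow V) (d k \<phi>) (d k \<phi>)"
    by (rule inner_on_simplices[OF linear_between_in[OF d_linear[OF assms(1)] assms(2)]])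
  also have "\<dots> = inner_on S (cobd \<phi>) (cobd \<phi>)"
    unfolding inner_on_def using S_subset finite_V
    by (intro sum.mono_neutral_cong_right) (auto simp: d_eq_cobd[OF assms])
  finally show ?thesis .
qed

text \<open>Faces of simplices are simplices, so the boundary of the complete complex preserves
  cochains of \<open>S\<close> and can serve as the adjoint without a restriction.\<close>

lemma bd_in_l2:
  assumes \<phi>: "\<phi> \<in> l2 S (k + 1)"
  shows "bd \<phi> \<in> l2 S k"
  unfolding l2_def
proof (intro CollectI allI impI)
  fix \<tau> assume \<tau>: "\<tau> \<notin> simplices S k"
  have "\<phi> (insert u \<tau>) = 0" if u: "u \<in> V - \<tau>" for u
  proof -
    have "insert u \<tau> \<notin> simplices S (k + 1)"
    proof
      assume "insert u \<tau> \<in> simplices S (k + 1)"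
      then have ins: "insert u \<tau> \<in> S" "int (card (insert u \<tau>)) = k + 2" by (auto simp: simplices_def)
      then have "\<tau> \<in> S" by (auto intro: faces)
      moreover from this have "finite \<tau>" using S_subset finite_subset_V by blast
      ultimately show False using \<tau> ins(2) u by (simp add: simplices_def)
    qed
    then show ?thesis using \<phi> by (simp add: l2_def)
  qed
  then show "bd \<phi> \<tau> = 0" by (simp add: bd_def)
qed

lemma bd_adjoint:
  assumes k: "k \<ge> -1" and \<phi>: "\<phi> \<in> l2 S k" and \<psi>: "\<psi> \<in> l2 S (k + 1)"
  shows "inner_on (simplices S (k + 1)) (d k \<phi>) \<psi> = inner_on (simplices S k) \<phi> (bd \<psi>)"
proof -
  have "inner_on (simplices S (k + 1)) (d k \<phi>) \<psi> = inner_on (Pow V) (d k \<phi>) \<psi>"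
    by (rule inner_on_simplices[OF linear_between_in[OF d_linear[OF k] \<phi>]])
  also have "\<dots> = inner_on (Pow V) (cobd \<phi>) \<psi>"
    unfolding inner_on_def using \<psi>
    by (intro sum.cong) (auto simp: d_eq_cobd[OF k \<phi>] l2_def simplices_def)
  also have "\<dots> = inner_on (Pow V) \<phi> (bd \<psi>)"
    using bd_cobd_adjoint[of \<psi> \<phi>] by (simp add: inner_on_commute)
  also have "\<dots> = inner_on (simplices S k) \<phi> (bd \<psi>)" by (rule inner_on_simplices[OF \<phi>, symmetric])
  finally show ?thesis .
qed

text \<open>\<open>bd\<close> shows that the choice in \<open>boundary\<close> has a witness. Any
  two adjoints agree on \<open>l2 S (k + 1)\<close>, since pairing with an indicator reads off a
  coordinate.\<close>

lemma boundary_eq_bd: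
  assumes k: "k \<ge> -1" and \<psi>: "\<psi> \<in> l2 S (k + 1)"
  shows "boundary S d k \<psi> = bd \<psi>"
proof -
  define adj where "adj = (\<lambda>T. T \<in> l2 S (k + 1) \<rightarrow> l2 S k \<and>
     (\<forall>\<phi>\<in>l2 S k. \<forall>\<psi>\<in>l2 S (k + 1).
        l2_inner S (k + 1) (d k \<phi>) \<psi> = l2_inner S k \<phi> (T \<psi>)))"
  have "adj bd"
    using bd_in_l2 bd_adjoint[OF k] by (auto simp: adj_def l2_inner_eq_inner_on)
  then have "adj (SOME T. adj T)" by (rule someI[of adj])
  moreover have "boundary S d k = (SOME T. adj T)" by (simp only: boundary_def adj_def)
  ultimately have adj: "adj (boundary S d k)" by simp
  show ?thesis
  proof
    fix \<tau>
    show "boundary S d k \<psi> \<tau> = bd \<psi> \<tau>"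
    proof (cases "\<tau> \<in> simplices S k")
      case True
      then have ind: "indicator {\<tau>} \<in> l2 S k" unfolding l2_eq_funs_on by (rule indicator_in_funs_on)
      have "inner_on (simplices S k) (indicator {\<tau>}) (boundary S d k \<psi>)
          = inner_on (simplices S (k + 1)) (d k (indicator {\<tau>})) \<psi>"
        using adj ind \<psi> unfolding adj_def l2_inner_eq_inner_on by metis
      also have "\<dots> = inner_on (simplices S k) (indicator {\<tau>}) (bd \<psi>)"
        by (rule bd_adjoint[OF k ind \<psi>])
      finally show ?thesis by (simp only: inner_on_indicator[OF finite_simplices True])
    next
      case False
      have "boundary S d k \<psi> \<in> l2 S k" using adj \<psi> unfolding adj_def by blast
      then show ?thesis using bd_in_l2[OF \<psi>] False by (simp add: l2_def)
    qed
  qed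
qed

lemma bd_add: "bd (\<lambda>x. \<phi> x + \<psi> x) = (\<lambda>x. bd \<phi> x + bd \<psi> x)"
  by (auto simp: bd_def distrib_left sum.distrib)

lemma bd_scale: "bd (\<lambda>x. c * \<phi> x) = (\<lambda>x. c * bd \<phi> x)"
  by (auto simp: bd_def sum_distrib_left mult.left_commute)

section \<open>The Hodge Laplacian in nonnegative dimensions\<close>

context
  fixes k :: int
  assumes k: "k \<ge> 0"
begin

lemma indices: "k \<ge> -1" "k - 1 \<ge> -1"
  using k by auto

lemma bd_in_l2': "\<phi> \<in> l2 S k \<Longrightarrow> bd \<phi> \<in> l2 S (k - 1)"
  using bd_in_l2[of \<phi> "k - 1"] by simp

lemma hodge_eq:
  assumes \<phi>: "\<phi> \<in> l2 S k"
  shows "hodge_laplacian S d k \<phi> = (\<lambda>\<tau>. bd (d k \<phi>) \<tau> + d (k - 1) (bd \<phi>) \<tau>)"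
  using boundary_eq_bd[OF indices(1) linear_between_in[OF d_linear[OF indices(1)] \<phi>]]
    boundary_eq_bd[OF indices(2), of \<phi>] \<phi> by (simp add: hodge_laplacian_def)

text \<open>Adjointness in both summands. The right side is visibly symmetric in
  \<open>\<phi>\<close> and \<open>\<psi>\<close>, and for \<open>\<psi> = \<phi>\<close> it
  consists of the norms in \<open>defect_eq\<close>.\<close>

lemma hodge_inner:
  assumes \<phi>: "\<phi> \<in> l2 S k" and \<psi>: "\<psi> \<in> l2 S k"
  shows "inner_on (simplices S k) (hodge_laplacian S d k \<phi>) \<psi> =
    inner_on (simplices S (k + 1)) (d k \<phi>) (d k \<psi>) + inner_on (simplices S (k - 1)) (bd \<phi>) (bd \<psi>)"
proof -
  have "inner_on (simplices S k) (bd (d k \<phi>)) \<psi> = inner_on (simplices S (k + 1)) (d k \<phi>) (d k \<psi>)"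
    using bd_adjoint[OF indices(1) \<psi> linear_between_in[OF d_linear[OF indices(1)] \<phi>]]
    by (simp only: inner_on_commute[of _ \<psi>] inner_on_commute[of _ "d k \<psi>"])
  moreover have "inner_on (simplices S k) (d (k - 1) (bd \<phi>)) \<psi> = inner_on (simplices S (k - 1)) (bd \<phi>) (bd \<psi>)"
    using bd_adjoint[OF indices(2) bd_in_l2'[OF \<phi>], of \<psi>] \<psi> by simp
  ultimately show ?thesis by (simp add: hodge_eq[OF \<phi>] inner_on_add_left)
qed

lemma hodge_linear: "linear_between (l2 S k) (l2 S k) (hodge_laplacian S d k)"
  unfolding linear_between_def
proof (intro conjI ballI allI)
  note d0 = d_linear[OF indices(1)]
  have d1: "linear_between (l2 S (k - 1)) (l2 S k) (d (k - 1))"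
    using d_linear[OF indices(2)] by simp
  show "hodge_laplacian S d k \<in> l2 S k \<rightarrow> l2 S k"
  proof
    fix \<phi> assume \<phi>: "\<phi> \<in> l2 S k"
    have "bd (d k \<phi>) \<in> l2 S k" "d (k - 1) (bd \<phi>) \<in> l2 S k"
      using linear_between_in[OF d0 \<phi>] bd_in_l2 linear_between_in[OF d1 bd_in_l2'[OF \<phi>]] by auto
    then show "hodge_laplacian S d k \<phi> \<in> l2 S k" by (simp add: hodge_eq[OF \<phi>] l2_def)
  qed
  fix \<phi> assume \<phi>: "\<phi> \<in> l2 S k"
  show "hodge_laplacian S d k (\<lambda>x. \<phi> x + \<psi> x) =
      (\<lambda>x. hodge_laplacian S d k \<phi> x + hodge_laplacian S d k \<psi> x)" if \<psi>: "\<psi> \<in> l2 S k" for \<psi>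
  proof -
    have "(\<lambda>x. \<phi> x + \<psi> x) \<in> l2 S k" using \<phi> \<psi> by (simp add: l2_def)
    then show ?thesis
      by (simp add: hodge_eq \<phi> \<psi> bd_add linear_between_add[OF d0 \<phi> \<psi>]
          linear_between_add[OF d1 bd_in_l2'[OF \<phi>] bd_in_l2'[OF \<psi>]] algebra_simps)
  qed
  show "hodge_laplacian S d k (\<lambda>x. c * \<phi> x) = (\<lambda>x. c * hodge_laplacian S d k \<phi> x)" for c
  proof -
    have "(\<lambda>x. c * \<phi> x) \<in> l2 S k" using \<phi> by (simp add: l2_def)
    then show ?thesis
      by (simp add: hodge_eq \<phi> bd_scale linear_between_scale[OF d0 \<phi>]
          linear_between_scale[OF d1 bd_in_l2'[OF \<phi>]] algebra_simps)
  qed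
qed

text \<open>The defect is \<open>card V\<close> times the squared norm minus the quadratic form of
  the Laplacian, and that form is bounded below by the smallest eigenvalue.\<close>

lemma defect_le_mu_hodge:
  assumes \<phi>: "\<phi> \<in> l2 S k"
  shows "defect S \<phi> \<le> (real (card V) - mu_hodge S d k) * inner_on (Pow V) \<phi> \<phi>"
proof -
  interpret symmetric_operator "simplices S k" "hodge_laplacian S d k"
  proof
    fix \<phi> \<psi> assume "\<phi> \<in> funs_on (simplices S k)" "\<psi> \<in> funs_on (simplices S k)"
    then have *: "\<phi> \<in> l2 S k" "\<psi> \<in> l2 S k" by (simp_all add: l2_eq_funs_on)
    show "inner_on (simplices S k) (hodge_laplacian S d k \<phi>) \<psi>
        = inner_on (simplices S k) \<phi> (hodge_laplacian S d k \<psi>)"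
      by (subst (2) inner_on_commute)
        (simp add: hodge_inner * inner_on_commute[of _ "d k \<phi>" "d k \<psi>"] inner_on_commute[of _ "bd \<phi>" "bd \<psi>"])
  qed (use finite_simplices hodge_linear in \<open>auto simp: l2_eq_funs_on\<close>)
  have "mu_hodge S d k * inner_on (Pow V) \<phi> \<phi> \<le> inner_on (simplices S k) (hodge_laplacian S d k \<phi>) \<phi>"
    using Min_spectrum_le[of \<phi>] \<phi> inner_on_simplices[OF \<phi>]
    by (simp add: mu_hodge_def l2_eq_funs_on)
  also have "\<dots> = inner_on S (cobd \<phi>) (cobd \<phi>) + inner_on (Pow V) (bd \<phi>) (bd \<phi>)"
    using inner_on_d[OF indices(1) \<phi>] inner_on_simplices[OF bd_in_l2'[OF \<phi>]]
    by (simp add: hodge_inner[OF \<phi> \<phi>])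
  also have "\<dots> = real (card V) * inner_on (Pow V) \<phi> \<phi> - defect S \<phi>"
    using defect_eq[OF S_subset, of \<phi>] by simp
  finally show ?thesis by (simp add: algebra_simps)
qed

lemma defect_harmonic:
  assumes \<phi>: "\<phi> \<in> l2 S k" and "d k \<phi> = (\<lambda>_. 0)" "bd \<phi> = (\<lambda>_. 0)"
  shows "defect S \<phi> = real (card V) * inner_on (Pow V) \<phi> \<phi>"
  using defect_eq[OF S_subset, of \<phi>] inner_on_d[OF indices(1) \<phi>] assms(2,3) by simp

text \<open>\<open>\<eta>\<close> is the residual of the orthogonal projection of
  \<open>\<phi>\<close> to the coboundaries. It remains a cocycle since \<open>d\<close> squares to
  zero.\<close>

lemma cocycle_coboundary_plus_harmonic:
  assumes \<phi>: "\<phi> \<in> l2 S k" "d k \<phi> = (\<lambda>_. 0)"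
  obtains w \<eta> where "w \<in> l2 S (k - 1)" "\<eta> \<in> l2 S k" "d k \<eta> = (\<lambda>_. 0)" "bd \<eta> = (\<lambda>_. 0)"
    "\<phi> = (\<lambda>x. d (k - 1) w x + \<eta> x)"
proof -
  have d1: "linear_between (l2 S (k - 1)) (l2 S k) (d (k - 1))"
    using d_linear[OF indices(2)] by simp
  obtain w where w: "w \<in> l2 S (k - 1)"
    and perp: "\<And>v. v \<in> l2 S (k - 1) \<Longrightarrow>
      inner_on (simplices S k) (\<lambda>x. \<phi> x - d (k - 1) w x) (d (k - 1) v) = 0"
    using orthogonal_projection_range[OF finite_simplices finite_simplices d1[unfolded l2_eq_funs_on]]
    unfolding l2_eq_funs_on by blast
  have dw: "d (k - 1) w \<in> l2 S k" by (rule linear_between_in[OF d1 w])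
  define \<eta> where "\<eta> = (\<lambda>x. \<phi> x - d (k - 1) w x)"
  have \<eta>: "\<eta> \<in> l2 S k" using \<phi>(1) dw by (simp add: \<eta>_def l2_def)
  have "d k \<eta> = (\<lambda>x. d k \<phi> x - d k (d (k - 1) w) x)"
    unfolding \<eta>_def
    by (rule linear_between_diff[OF d_linear[OF indices(1), unfolded l2_eq_funs_on]
          \<phi>(1)[unfolded l2_eq_funs_on] dw[unfolded l2_eq_funs_on]])
  then have d\<eta>: "d k \<eta> = (\<lambda>_. 0)" using d_d[OF indices(2) w] \<phi>(2) by simp
  have "inner_on (simplices S (k - 1)) (bd \<eta>) (bd \<eta>) = inner_on (simplices S k) (d (k - 1) (bd \<eta>)) \<eta>"
    using bd_adjoint[OF indices(2) bd_in_l2'[OF \<eta>], of \<eta>] \<eta> by simp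
  also have "\<dots> = inner_on (simplices S k) \<eta> (d (k - 1) (bd \<eta>))" by (rule inner_on_commute)
  \<comment> \<open>Orthogonality to the coboundaries, tested at \<open>v = bd \<eta>\<close>, turns
    the squared norm of \<open>bd \<eta>\<close> into 0.\<close>
  also have "\<dots> = 0" unfolding \<eta>_def by (rule perp) (use bd_in_l2'[OF \<eta>] in \<open>simp add: \<eta>_def\<close>)
  finally have bd\<eta>: "bd \<eta> = (\<lambda>_. 0)"
    by (rule inner_on_self_eq_0[OF finite_simplices bd_in_l2'[OF \<eta>, unfolded l2_eq_funs_on]])
  have "\<phi> = (\<lambda>x. d (k - 1) w x + \<eta> x)" by (simp add: \<eta>_def)
  with w \<eta> d\<eta> bd\<eta> show ?thesis by (rule that)
qed

section \<open>Cohomology as a quotient group\<close>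

lemma cocycle_comm_group: "comm_group (cocycle_group S d k)"
proof (rule comm_groupI)
  note d0 = d_linear[OF indices(1)]
  fix \<phi> \<psi> assume \<phi>: "\<phi> \<in> carrier (cocycle_group S d k)" and \<psi>: "\<psi> \<in> carrier (cocycle_group S d k)"
  then have "d k (\<lambda>\<tau>. \<phi> \<tau> + \<psi> \<tau>) = (\<lambda>_. 0)"
    using linear_between_add[OF d0, of \<phi> \<psi>] by (simp add: cocycle_group_def)
  then show "\<phi> \<otimes>\<^bsub>cocycle_group S d k\<^esub> \<psi> \<in> carrier (cocycle_group S d k)"
    using \<phi> \<psi> by (simp add: cocycle_group_def l2_def)
  show "\<phi> \<otimes>\<^bsub>cocycle_group S d k\<^esub> \<psi> = \<psi> \<otimes>\<^bsub>cocycle_group S d k\<^esub> \<phi>"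
    by (simp add: cocycle_group_def add.commute)
next
  fix \<phi> assume \<phi>: "\<phi> \<in> carrier (cocycle_group S d k)"
  then have "d k (\<lambda>\<tau>. -1 * \<phi> \<tau>) = (\<lambda>\<tau>. 0)"
    using linear_between_scale[OF d_linear[OF indices(1)], of \<phi> "-1"] by (simp add: cocycle_group_def)
  then show "\<exists>\<psi>\<in>carrier (cocycle_group S d k). \<psi> \<otimes>\<^bsub>cocycle_group S d k\<^esub> \<phi> = \<one>\<^bsub>cocycle_group S d k\<^esub>"
    using \<phi> by (intro bexI[of _ "\<lambda>\<tau>. -1 * \<phi> \<tau>"]) (auto simp: cocycle_group_def l2_def)
next
  show "\<one>\<^bsub>cocycle_group S d k\<^esub> \<in> carrier (cocycle_group S d k)"
    using linear_between_zero[OF d_linear[OF indices(1), unfolded l2_eq_funs_on]]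
    by (simp add: cocycle_group_def l2_def)
qed (auto simp: cocycle_group_def add.assoc)

lemma coboundaries_are_cocycles: "d (k - 1) ` l2 S (k - 1) \<subseteq> carrier (cocycle_group S d k)"
  using d_d[OF indices(2)] linear_between_in[OF d_linear[OF indices(2)]]
  by (auto simp: cocycle_group_def)

text \<open>Without harmonic cochains every cocycle is a coboundary, and the quotient of a group by
  its whole carrier has a single coset.\<close>

lemma trivial_cohomology:
  assumes "\<And>\<eta>. \<eta> \<in> l2 S k \<Longrightarrow> d k \<eta> = (\<lambda>_. 0) \<Longrightarrow> bd \<eta> = (\<lambda>_. 0) \<Longrightarrow> \<eta> = (\<lambda>_. 0)"
  shows "trivial_group (reduced_cohomology S d k)"
proof -
  interpret comm_group "cocycle_group S d k" by (rule cocycle_comm_group)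
  have "\<phi> \<in> d (k - 1) ` l2 S (k - 1)" if "\<phi> \<in> carrier (cocycle_group S d k)" for \<phi>
  proof -
    from that have "\<phi> \<in> l2 S k" "d k \<phi> = (\<lambda>_. 0)" by (auto simp: cocycle_group_def)
    then obtain w \<eta> where w: "w \<in> l2 S (k - 1)" and \<eta>: "\<eta> \<in> l2 S k" "d k \<eta> = (\<lambda>_. 0)" "bd \<eta> = (\<lambda>_. 0)"
      and \<phi>: "\<phi> = (\<lambda>x. d (k - 1) w x + \<eta> x)"
      by (rule cocycle_coboundary_plus_harmonic)
    have "\<phi> = d (k - 1) w" unfolding \<phi> assms[OF \<eta>] by simp
    then show ?thesis using w by blast
  qed
  then have eq: "d (k - 1) ` l2 S (k - 1) = carrier (cocycle_group S d k)"
    using coboundaries_are_cocycles by blast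
  have "subgroup (carrier (cocycle_group S d k)) (cocycle_group S d k)" by (rule subgroup_self)
  then have "group (reduced_cohomology S d k)"
    unfolding reduced_cohomology_def eq
    by (intro normal.factorgroup_is_group subgroup_imp_normal)
  moreover have "carrier (reduced_cohomology S d k) = {one (reduced_cohomology S d k)}"
    unfolding reduced_cohomology_def eq FactGroup_def
    by (simp add: RCOSETS_def coset_join2 subgroup_self) (use one_closed in blast)
  ultimately show ?thesis by (simp add: trivial_group_def)
qed

end

section \<open>From the spectral gap to vanishing cohomology\<close>

lemma trivial_cohomology_of_spectral_gap:
  fixes k l :: nat
  assumes "l + 1 \<le> k"
    and gap: "mu_hodge S d (int l) >
      real (card V) * (1 - fact (l + 1) / fact (k + 1) *
        (\<Prod>j = l + 1..k. real j + 1 - real_of_int (beta V S (int j))))"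
  shows "trivial_group (reduced_cohomology S d (int k))"
proof (rule trivial_cohomology)
  define P where "P = (\<Prod>j = l + 1..k. real j + 1 - real_of_int (beta V S (int j)))"
  define c where "c = real (card V) - mu_hodge S d (int l)"
  \<comment> \<open>The reciprocal of the factorial quotient in the gap; as it is positive, the gap
    can be rewritten as \<open>q * c < real (card V) * P\<close>.\<close>
  define q :: real where "q = fact (k + 1) / fact (l + 1)"
  have q: "q > 0" by (simp add: q_def)
  have "c < real (card V) * (P / q)"
    using gap by (simp add: c_def P_def q_def algebra_simps)
  then have qc: "q * c < real (card V) * P" using q by (simp add: field_simps)
  fix \<eta> assume \<eta>: "\<eta> \<in> l2 S (int k)" "d (int k) \<eta> = (\<lambda>_. 0)" "bd \<eta> = (\<lambda>_. 0)"
  have "P * defect S \<eta> \<le> q * c * inner_on (Pow V) \<eta> \<eta>"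
    unfolding P_def q_def c_def using assms(1)
    by (intro defect_bound_raise[OF complex] defect_le_mu_hodge \<eta>(1)) auto
  \<comment> \<open>The defect of a harmonic cochain is \<open>card V\<close> times its squared
    norm; the coefficient that results is positive by \<open>qc\<close>, which forces the norm to
    vanish.\<close>
  then have "(real (card V) * P - q * c) * inner_on (Pow V) \<eta> \<eta> \<le> 0"
    using defect_harmonic[OF _ \<eta>] by (simp add: algebra_simps)
  then have "inner_on (Pow V) \<eta> \<eta> = 0"
    using qc inner_on_self_nonneg[of "Pow V" \<eta>] by (simp add: mult_le_0_iff)
  moreover have "\<eta> \<in> funs_on (Pow V)"
    using l2_complete[OF \<eta>(1)] by (auto simp: l2_def funs_on_def simplices_def)
  ultimately show "\<eta> = (\<lambda>_. 0)" using finite_V by (intro inner_on_self_eq_0[of "Pow V"]) auto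
qed simp

end

theorem corollary4p5:
  fixes V :: "'a set" and S :: "'a set set" and dhat :: "'a graded_operator"
    and k l :: nat
  defines "d \<equiv> induced_coboundary S dhat"
  assumes "finite V"
    and "simplicial_complex V S"
    and "coboundary_operators (Pow V) dhat"
    and "l + 1 \<le> k"
    and "simplices S (int l) \<noteq> {}"
    and "mu_hodge S d (int l) >
      real (card V) * (1 - fact (l + 1) / fact (k + 1) *
        (\<Prod>j = l + 1..k. real j + 1 - real_of_int (beta V S (int j))))"
  shows "trivial_group (reduced_cohomology S d (int k))"
proof -
  interpret induced_complex V dhat S
    using assms by unfold_locales auto
  show ?thesis
    using trivial_cohomology_of_spectral_gap assms(5,7) unfolding d_def by blast
qed

end
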